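(* Let $(\mathsf{A},\circledast)$ be a complemented category with generator $X$. Assume that the category of $\mathsf{A}$-modules is locally Noetherian, and let $M$ be a finitely generated $\mathsf{A}$-module over a Noetherian ring $\mathbf{k}$. For $N\ge 0$, let $\mathsf{A}^N$ denote the full subcategory of $\mathsf{A}$ spanned by the objects whose $X$-ranks are at most $N$. Then the following hold. (1) (Injective representation stability) There is an integer $N_1$ such that for every $\mathsf{A}$-morphism $f:V\to W$ with $X$-rank of $V$ at least $N_1$, the homomorphism $M_f:M_V\to M_W$ is injective. (2) (Surjective representation stability) There is an integer $N_2$ such that for every $\mathsf{A}$-morphism $f:V\to W$ with $X$-rank of $V$ at least $N_2$, the orbit under $\operatorname{Aut}_{\mathsf{A}}(W)$ of the image of $M_f:M_V\to M_W$ spans $M_W$. (3) (Central stability) For all sufficiently large $N$, the functor $M$ is the left Kan extension to $\mathsf{A}$ of the restriction of $M$ to $\mathsf{A}^N$.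
   Context: All rings are commutative with $1$. Complemented categories. A complemented category with generator is a symmetric monoidal category $(\mathsf{A},\circledast)$, with identity object $\mathbf{1}$, satisfying: (i) every morphism is a monomorphism (so for a morphism $f:V\to V'$ one may speak of the subobject $f(V)$ of $V'$); (ii) $\mathbf{1}$ is initial; hence for objects $V,V'$ there are canonical morphisms $V\cong V\circledast\mathbf{1}\to V\circledast V'$ and $V'\cong\mathbf{1}\circledast V'\to V\circledast V'$; (iii) for all $V,V',W$ the map $\operatorname{Hom}(V\circledast V',W)\to\operatorname{Hom}(V,W)\times\operatorname{Hom}(V',W)$ given by composing with the canonical morphisms is injective; (iv) every subobject $C$ of an object $V$ has a unique complement, that is, a unique subobject $D$ of $V$ such that there is an isomorphism $C\circledast D\to V$ whose compositions with the canonical morphisms $C\to C\circledast D$ and $D\to C\circledast D$ are the inclusions; (v) the canonical map from the wreath product $\mathfrak{S}_p\wr\operatorname{Aut}(X)$ to $\operatorname{Aut}(X^p)$ is injective for all $p$, where $X^p$ is the $p$-fold $\circledast$-power; (vi) $X$ is a generator: every object $V$ is isomorphic to $X^i$ for a unique $i\ge 0$, called the $X$-rank of $V$. Modules. An $\mathsf{A}$-module over $\mathbf{k}$ is a functor $M$ from $\mathsf{A}$ to $\mathbf{k}$-modules, with values denoted $M_V$ and $M_f$; submodules are defined pointwise. $M$ is finitely generated if there are finitely many objects $V_i$ and elements $x_i\in M_{V_i}$ such that the smallest submodule of $M$ containing all $x_i$ is $M$. The category of $\mathsf{A}$-modules is locally Noetherian if, for every Noetherian ring $\mathbf{k}$,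 every submodule of a finitely generated $\mathsf{A}$-module over $\mathbf{k}$ is finitely generated. *)

theory Defs
  imports "HOL-Algebra.Module" "HOL-Algebra.Ring_Divisibility" "HOL-Combinatorics.Permutations"
begin

section \<open>Categories and symmetric monoidal categories\<close>

record ('o, 'm) category =
  Obj :: "'o set"
  Arr :: "'m set"
  Dom :: "'m \<Rightarrow> 'o"
  Cod :: "'m \<Rightarrow> 'o"
  Ide :: "'o \<Rightarrow> 'm"
  comp_arr :: "'m \<Rightarrow> 'm \<Rightarrow> 'm" (infixl \<open>\<cdot>\<index>\<close> 70)

definition Hom :: "('o, 'm, 'z) category_scheme \<Rightarrow> 'o \<Rightarrow> 'o \<Rightarrow> 'm set" where
  "Hom C V W = {f \<in> Arr C. Dom C f = V \<and> Cod C f = W}"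

locale category =
  fixes C :: "('o, 'm, 'z) category_scheme" (structure)
  assumes Dom_Obj: "f \<in> Arr C \<Longrightarrow> Dom C f \<in> Obj C"
    and Cod_Obj: "f \<in> Arr C \<Longrightarrow> Cod C f \<in> Obj C"
    and Ide_Hom: "V \<in> Obj C \<Longrightarrow> Ide C V \<in> Hom C V V"
    and comp_Hom: "f \<in> Hom C U V \<Longrightarrow> g \<in> Hom C V W \<Longrightarrow> g \<cdot> f \<in> Hom C U W"
    and comp_Ide: "f \<in> Hom C V W \<Longrightarrow> f \<cdot> Ide C V = f"
    and Ide_comp: "f \<in> Hom C V W \<Longrightarrow> Ide C W \<cdot> f = f"
    and comp_assoc: "f \<in> Hom C U V \<Longrightarrow> g \<in> Hom C V W \<Longrightarrow> h \<in> Hom C W Z \<Longrightarrow>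
      (h \<cdot> g) \<cdot> f = h \<cdot> (g \<cdot> f)"

definition monomorphism :: "('o, 'm, 'z) category_scheme \<Rightarrow> 'm \<Rightarrow> bool" where
  "monomorphism C f \<longleftrightarrow> f \<in> Arr C \<and>
     (\<forall>U \<in> Obj C. \<forall>g \<in> Hom C U (Dom C f). \<forall>h \<in> Hom C U (Dom C f).
        f \<cdot>\<^bsub>C\<^esub> g = f \<cdot>\<^bsub>C\<^esub> h \<longrightarrow> g = h)"

definition inverse_arrows :: "('o, 'm, 'z) category_scheme \<Rightarrow> 'm \<Rightarrow> 'm \<Rightarrow> bool" where
  "inverse_arrows C f g \<longleftrightarrow> f \<in> Arr C \<and> g \<in> Hom C (Cod C f) (Dom C f) \<and>
     g \<cdot>\<^bsub>C\<^esub> f = Ide C (Dom C f) \<and> f \<cdot>\<^bsub>C\<^esub> g = Ide C (Cod C f)"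

definition isomorphism :: "('o, 'm, 'z) category_scheme \<Rightarrow> 'm \<Rightarrow> bool" where
  "isomorphism C f \<longleftrightarrow> (\<exists>g. inverse_arrows C f g)"

definition inverse_arrow :: "('o, 'm, 'z) category_scheme \<Rightarrow> 'm \<Rightarrow> 'm" where
  "inverse_arrow C f = (THE g. inverse_arrows C f g)"

definition isomorphic :: "('o, 'm, 'z) category_scheme \<Rightarrow> 'o \<Rightarrow> 'o \<Rightarrow> bool" where
  "isomorphic C V W \<longleftrightarrow> (\<exists>f \<in> Hom C V W. isomorphism C f)"

definition Aut :: "('o, 'm, 'z) category_scheme \<Rightarrow> 'o \<Rightarrow> 'm set" where
  "Aut C V = {f \<in> Hom C V V. isomorphism C f}"

definition full_subcategory ::
  "('o, 'm, 'z) category_scheme \<Rightarrow> 'o set \<Rightarrow> ('o, 'm, 'z) category_scheme" where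
  "full_subcategory C S =
     C\<lparr>Obj := S, Arr := {f \<in> Arr C. Dom C f \<in> S \<and> Cod C f \<in> S}\<rparr>"

record ('o, 'm) monoidal_category = "('o, 'm) category" +
  unit_obj :: "'o"
  tensor_obj :: "'o \<Rightarrow> 'o \<Rightarrow> 'o" (infixl \<open>\<diamondop>\<index>\<close> 75)
  tensor_arr :: "'m \<Rightarrow> 'm \<Rightarrow> 'm" (infixl \<open>\<star>\<index>\<close> 75)
  associator :: "'o \<Rightarrow> 'o \<Rightarrow> 'o \<Rightarrow> 'm"
  left_unitor :: "'o \<Rightarrow> 'm"
  right_unitor :: "'o \<Rightarrow> 'm"
  braiding :: "'o \<Rightarrow> 'o \<Rightarrow> 'm"

locale symmetric_monoidal_category = category A
  for A :: "('o, 'm, 'z) monoidal_category_scheme" (structure) +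
  assumes unit_Obj: "unit_obj A \<in> Obj A"
    and tensor_Obj: "V \<in> Obj A \<Longrightarrow> W \<in> Obj A \<Longrightarrow> V \<diamondop> W \<in> Obj A"
    and tensor_Hom: "f \<in> Hom A V V' \<Longrightarrow> g \<in> Hom A W W' \<Longrightarrow> f \<star> g \<in> Hom A (V \<diamondop> W) (V' \<diamondop> W')"
    and tensor_Ide: "V \<in> Obj A \<Longrightarrow> W \<in> Obj A \<Longrightarrow> Ide A V \<star> Ide A W = Ide A (V \<diamondop> W)"
    and tensor_comp: "f \<in> Hom A V V' \<Longrightarrow> f' \<in> Hom A V' V'' \<Longrightarrow> g \<in> Hom A W W' \<Longrightarrow>
      g' \<in> Hom A W' W'' \<Longrightarrow> (f' \<cdot> f) \<star> (g' \<cdot> g) = (f' \<star> g') \<cdot> (f \<star> g)"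
    and assoc_Hom: "U \<in> Obj A \<Longrightarrow> V \<in> Obj A \<Longrightarrow> W \<in> Obj A \<Longrightarrow>
      associator A U V W \<in> Hom A ((U \<diamondop> V) \<diamondop> W) (U \<diamondop> (V \<diamondop> W))"
    and assoc_iso: "U \<in> Obj A \<Longrightarrow> V \<in> Obj A \<Longrightarrow> W \<in> Obj A \<Longrightarrow> isomorphism A (associator A U V W)"
    and assoc_natural: "f \<in> Hom A U U' \<Longrightarrow> g \<in> Hom A V V' \<Longrightarrow> h \<in> Hom A W W' \<Longrightarrow>
      associator A U' V' W' \<cdot> ((f \<star> g) \<star> h) = (f \<star> (g \<star> h)) \<cdot> associator A U V W"
    and lunit_Hom: "V \<in> Obj A \<Longrightarrow> left_unitor A V \<in> Hom A (unit_obj A \<diamondop> V) V"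
    and lunit_iso: "V \<in> Obj A \<Longrightarrow> isomorphism A (left_unitor A V)"
    and lunit_natural: "f \<in> Hom A V W \<Longrightarrow>
      left_unitor A W \<cdot> (Ide A (unit_obj A) \<star> f) = f \<cdot> left_unitor A V"
    and runit_Hom: "V \<in> Obj A \<Longrightarrow> right_unitor A V \<in> Hom A (V \<diamondop> unit_obj A) V"
    and runit_iso: "V \<in> Obj A \<Longrightarrow> isomorphism A (right_unitor A V)"
    and runit_natural: "f \<in> Hom A V W \<Longrightarrow>
      right_unitor A W \<cdot> (f \<star> Ide A (unit_obj A)) = f \<cdot> right_unitor A V"
    and braid_Hom: "V \<in> Obj A \<Longrightarrow> W \<in> Obj A \<Longrightarrow> braiding A V W \<in> Hom A (V \<diamondop> W) (W \<diamondop> V)"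
    and braid_natural: "f \<in> Hom A V V' \<Longrightarrow> g \<in> Hom A W W' \<Longrightarrow>
      braiding A V' W' \<cdot> (f \<star> g) = (g \<star> f) \<cdot> braiding A V W"
    and braid_symmetric: "V \<in> Obj A \<Longrightarrow> W \<in> Obj A \<Longrightarrow>
      braiding A W V \<cdot> braiding A V W = Ide A (V \<diamondop> W)"
    and pentagon: "U \<in> Obj A \<Longrightarrow> V \<in> Obj A \<Longrightarrow> W \<in> Obj A \<Longrightarrow> Z \<in> Obj A \<Longrightarrow>
      associator A U V (W \<diamondop> Z) \<cdot> associator A (U \<diamondop> V) W Z =
      (Ide A U \<star> associator A V W Z) \<cdot> associator A U (V \<diamondop> W) Z \<cdot> (associator A U V W \<star> Ide A Z)"
    and triangle: "V \<in> Obj A \<Longrightarrow> W \<in> Obj A \<Longrightarrow>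
      (Ide A V \<star> left_unitor A W) \<cdot> associator A V (unit_obj A) W = right_unitor A V \<star> Ide A W"
    and hexagon: "U \<in> Obj A \<Longrightarrow> V \<in> Obj A \<Longrightarrow> W \<in> Obj A \<Longrightarrow>
      associator A V W U \<cdot> braiding A U (V \<diamondop> W) \<cdot> associator A U V W =
      (Ide A V \<star> braiding A U W) \<cdot> associator A V U W \<cdot> (braiding A U V \<star> Ide A W)"


section \<open>Complemented categories\<close>

definition initial_arrow :: "('o, 'm, 'z) monoidal_category_scheme \<Rightarrow> 'o \<Rightarrow> 'm" where
  "initial_arrow A V = (THE f. f \<in> Hom A (unit_obj A) V)"

definition can_left :: "('o, 'm, 'z) monoidal_category_scheme \<Rightarrow> 'o \<Rightarrow> 'o \<Rightarrow> 'm" where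
  "can_left A V W =
     (Ide A V \<star>\<^bsub>A\<^esub> initial_arrow A W) \<cdot>\<^bsub>A\<^esub> inverse_arrow A (right_unitor A V)"

definition can_right :: "('o, 'm, 'z) monoidal_category_scheme \<Rightarrow> 'o \<Rightarrow> 'o \<Rightarrow> 'm" where
  "can_right A V W =
     (initial_arrow A V \<star>\<^bsub>A\<^esub> Ide A W) \<cdot>\<^bsub>A\<^esub> inverse_arrow A (left_unitor A W)"

text \<open>A subobject of \<open>V\<close> is represented by a monomorphism with codomain \<open>V\<close>;
  two of these represent the same subobject if they are related by \<open>same_subobject\<close>.\<close>

definition same_subobject :: "('o, 'm, 'z) category_scheme \<Rightarrow> 'm \<Rightarrow> 'm \<Rightarrow> bool" where
  "same_subobject C c d \<longleftrightarrow>
     (\<exists>u \<in> Hom C (Dom C c) (Dom C d). isomorphism C u \<and> c = d \<cdot>\<^bsub>C\<^esub> u)"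

definition is_complement ::
  "('o, 'm, 'z) monoidal_category_scheme \<Rightarrow> 'o \<Rightarrow> 'm \<Rightarrow> 'm \<Rightarrow> bool" where
  "is_complement A V c d \<longleftrightarrow>
     (\<exists>\<phi> \<in> Hom A (Dom A c \<diamondop>\<^bsub>A\<^esub> Dom A d) V. isomorphism A \<phi> \<and>
        \<phi> \<cdot>\<^bsub>A\<^esub> can_left A (Dom A c) (Dom A d) = c \<and>
        \<phi> \<cdot>\<^bsub>A\<^esub> can_right A (Dom A c) (Dom A d) = d)"

primrec tensor_power :: "('o, 'm, 'z) monoidal_category_scheme \<Rightarrow> 'o \<Rightarrow> nat \<Rightarrow> 'o" where
  "tensor_power A X 0 = unit_obj A"
| "tensor_power A X (Suc p) = tensor_power A X p \<diamondop>\<^bsub>A\<^esub> X"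

primrec tensor_family ::
  "('o, 'm, 'z) monoidal_category_scheme \<Rightarrow> (nat \<Rightarrow> 'm) \<Rightarrow> nat \<Rightarrow> 'm" where
  "tensor_family A g 0 = Ide A (unit_obj A)"
| "tensor_family A g (Suc p) = tensor_family A g p \<star>\<^bsub>A\<^esub> g p"

text \<open>\<open>adj_swap A X p i\<close> is the automorphism of the \<open>p\<close>-th power of \<open>X\<close> that interchanges
  the tensor factors number \<open>i\<close> and \<open>i + 1\<close> (counted from 0, where \<open>i + 1 < p\<close>).\<close>

fun adj_swap :: "('o, 'm, 'z) monoidal_category_scheme \<Rightarrow> 'o \<Rightarrow> nat \<Rightarrow> nat \<Rightarrow> 'm" where
  "adj_swap A X (Suc (Suc p)) i =
     (if i = p
      then inverse_arrow A (associator A (tensor_power A X p) X X) \<cdot>\<^bsub>A\<^esub>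
           (Ide A (tensor_power A X p) \<star>\<^bsub>A\<^esub> braiding A X X) \<cdot>\<^bsub>A\<^esub>
           associator A (tensor_power A X p) X X
      else adj_swap A X (Suc p) i \<star>\<^bsub>A\<^esub> Ide A X)"
| "adj_swap A X p i = Ide A (tensor_power A X p)"

text \<open>The action of the symmetric group on the \<open>p\<close>-th power of \<open>X\<close> sends the transposition
  of \<open>i\<close> and \<open>i + 1\<close> to \<open>adj_swap A X p i\<close>; as these transpositions generate the group,
  this determines the action, and by coherence it is well defined.\<close>

inductive perm_action ::
  "('o, 'm, 'z) monoidal_category_scheme \<Rightarrow> 'o \<Rightarrow> nat \<Rightarrow> (nat \<Rightarrow> nat) \<Rightarrow> 'm \<Rightarrow> bool"
  for A X p where
  perm_action_id: "perm_action A X p id (Ide A (tensor_power A X p))"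
| perm_action_swap: "perm_action A X p \<pi> \<phi> \<Longrightarrow> Suc i < p \<Longrightarrow>
    perm_action A X p (Transposition.transpose i (Suc i) \<circ> \<pi>) (adj_swap A X p i \<cdot>\<^bsub>A\<^esub> \<phi>)"

definition perm_arrow ::
  "('o, 'm, 'z) monoidal_category_scheme \<Rightarrow> 'o \<Rightarrow> nat \<Rightarrow> (nat \<Rightarrow> nat) \<Rightarrow> 'm" where
  "perm_arrow A X p \<pi> = (THE \<phi>. perm_action A X p \<pi> \<phi>)"

text \<open>The underlying set of the wreath product consists of the pairs of a permutation of
  \<open>{..<p}\<close> and a family of automorphisms of \<open>X\<close> indexed by \<open>{..<p}\<close>.\<close>

definition wreath_carrier ::
  "('o, 'm, 'z) category_scheme \<Rightarrow> 'o \<Rightarrow> nat \<Rightarrow> ((nat \<Rightarrow> nat) \<times> (nat \<Rightarrow> 'm)) set" where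
  "wreath_carrier C X p = {\<pi>. \<pi> permutes {..<p}} \<times> ({..<p} \<rightarrow>\<^sub>E Aut C X)"

definition wreath_map ::
  "('o, 'm, 'z) monoidal_category_scheme \<Rightarrow> 'o \<Rightarrow> nat \<Rightarrow> (nat \<Rightarrow> nat) \<times> (nat \<Rightarrow> 'm) \<Rightarrow> 'm" where
  "wreath_map A X p = (\<lambda>(\<pi>, g). perm_arrow A X p \<pi> \<cdot>\<^bsub>A\<^esub> tensor_family A g p)"

locale complemented_category = symmetric_monoidal_category A
  for A :: "('o, 'm, 'z) monoidal_category_scheme" (structure) and X :: 'o +
  assumes all_mono: "f \<in> Arr A \<Longrightarrow> monomorphism A f"
    and unit_initial: "V \<in> Obj A \<Longrightarrow> \<exists>!f. f \<in> Hom A (unit_obj A) V"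
    and tensor_jointly_epi: "V \<in> Obj A \<Longrightarrow> V' \<in> Obj A \<Longrightarrow> W \<in> Obj A \<Longrightarrow>
      inj_on (\<lambda>f. (f \<cdot> can_left A V V', f \<cdot> can_right A V V')) (Hom A (V \<diamondop> V') W)"
    and complement_exists: "c \<in> Arr A \<Longrightarrow> \<exists>d \<in> Arr A. is_complement A (Cod A c) c d"
    and complement_unique: "c \<in> Arr A \<Longrightarrow> is_complement A (Cod A c) c d \<Longrightarrow>
      is_complement A (Cod A c) c d' \<Longrightarrow> d \<in> Arr A \<Longrightarrow> d' \<in> Arr A \<Longrightarrow> same_subobject A d d'"
    and wreath_inj: "inj_on (wreath_map A X p) (wreath_carrier A X p)"
    and generator_Obj: "X \<in> Obj A"
    and generator: "V \<in> Obj A \<Longrightarrow> \<exists>!i. isomorphic A V (tensor_power A X i)"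

definition gen_rank :: "('o, 'm, 'z) monoidal_category_scheme \<Rightarrow> 'o \<Rightarrow> 'o \<Rightarrow> nat" where
  "gen_rank A X V = (THE i. isomorphic A V (tensor_power A X i))"

definition rank_subcategory ::
  "('o, 'm, 'z) monoidal_category_scheme \<Rightarrow> 'o \<Rightarrow> nat \<Rightarrow> ('o, 'm, 'z) monoidal_category_scheme" where
  "rank_subcategory A X N = full_subcategory A {V \<in> Obj A. gen_rank A X V \<le> N}"


section \<open>Modules over a category\<close>

definition mod_hom ::
  "('k, 'r) ring_scheme \<Rightarrow> ('k, 'b, 's) module_scheme \<Rightarrow> ('k, 'c, 't) module_scheme \<Rightarrow> ('b \<Rightarrow> 'c) set"
  where
  "mod_hom R P Q = {h \<in> carrier P \<rightarrow> carrier Q.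
     (\<forall>x \<in> carrier P. \<forall>y \<in> carrier P. h (x \<oplus>\<^bsub>P\<^esub> y) = h x \<oplus>\<^bsub>Q\<^esub> h y) \<and>
     (\<forall>a \<in> carrier R. \<forall>x \<in> carrier P. h (a \<odot>\<^bsub>P\<^esub> x) = a \<odot>\<^bsub>Q\<^esub> h x)}"

definition mod_span ::
  "('k, 'r) ring_scheme \<Rightarrow> ('k, 'b, 's) module_scheme \<Rightarrow> 'b set \<Rightarrow> 'b set" where
  "mod_span R P Z = \<Inter>{H. submodule H R P \<and> Z \<subseteq> H}"

record ('o, 'm, 'k, 'b) module_functor =
  Val :: "'o \<Rightarrow> ('k, 'b) module"
  Map :: "'m \<Rightarrow> 'b \<Rightarrow> 'b"

locale cat_module = cring R + category C
  for R :: "'k ring" and C :: "('o, 'm, 'z) category_scheme"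
    and M :: "('o, 'm, 'k, 'b) module_functor" +
  assumes Val_module: "V \<in> Obj C \<Longrightarrow> module R (Val M V)"
    and Map_hom: "f \<in> Hom C V W \<Longrightarrow> Map M f \<in> mod_hom R (Val M V) (Val M W)"
    and Map_Ide: "V \<in> Obj C \<Longrightarrow> x \<in> carrier (Val M V) \<Longrightarrow> Map M (Ide C V) x = x"
    and Map_comp: "f \<in> Hom C U V \<Longrightarrow> g \<in> Hom C V W \<Longrightarrow> x \<in> carrier (Val M U) \<Longrightarrow>
      Map M (g \<cdot>\<^bsub>C\<^esub> f) x = Map M g (Map M f x)"

definition cat_submodule ::
  "'k ring \<Rightarrow> ('o, 'm, 'z) category_scheme \<Rightarrow> ('o, 'm, 'k, 'b) module_functor \<Rightarrow> ('o \<Rightarrow> 'b set) \<Rightarrow> bool"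
  where
  "cat_submodule R C M S \<longleftrightarrow> (\<forall>V \<in> Obj C. submodule (S V) R (Val M V)) \<and>
     (\<forall>f \<in> Arr C. Map M f ` S (Dom C f) \<subseteq> S (Cod C f))"

definition sub_functor ::
  "('o, 'm, 'k, 'b) module_functor \<Rightarrow> ('o \<Rightarrow> 'b set) \<Rightarrow> ('o, 'm, 'k, 'b) module_functor" where
  "sub_functor M S = M\<lparr>Val := \<lambda>V. (Val M V)\<lparr>carrier := S V\<rparr>\<rparr>"

definition generated_by ::
  "'k ring \<Rightarrow> ('o, 'm, 'z) category_scheme \<Rightarrow> ('o, 'm, 'k, 'b) module_functor \<Rightarrow>
   ('o \<times> 'b) set \<Rightarrow> 'o \<Rightarrow> 'b set" where
  "generated_by R C M G V = \<Inter>{S V | S. cat_submodule R C M S \<and> (\<forall>(U, x) \<in> G. x \<in> S U)}"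

definition fin_generated ::
  "'k ring \<Rightarrow> ('o, 'm, 'z) category_scheme \<Rightarrow> ('o, 'm, 'k, 'b) module_functor \<Rightarrow> bool" where
  "fin_generated R C M \<longleftrightarrow>
     (\<exists>G. finite G \<and> (\<forall>(U, x) \<in> G. U \<in> Obj C \<and> x \<in> carrier (Val M U)) \<and>
        (\<forall>V \<in> Obj C. generated_by R C M G V = carrier (Val M V)))"

text \<open>A HOL formula cannot quantify over types, so the type \<open>'k\<close> of the coefficients and the type
  \<open>'b\<close> of the module elements are parameters of the following definition.  The type
  \<open>nat \<times> 'm \<Rightarrow> 'k\<close> is large enough for all finitely generated modules over rings on \<open>'k\<close>:
  see lemma \<open>locally_noetherian_any_type\<close> below.\<close>

definition locally_noetherian ::
  "'k itself \<Rightarrow> 'b itself \<Rightarrow> ('o, 'm, 'z) category_scheme \<Rightarrow> bool" where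
  "locally_noetherian _ _ C \<longleftrightarrow>
     (\<forall>(R :: 'k ring) (M :: ('o, 'm, 'k, 'b) module_functor) S.
        noetherian_ring R \<and> cat_module R C M \<and> fin_generated R C M \<and> cat_submodule R C M S \<longrightarrow>
        fin_generated R C (sub_functor M S))"

definition nat_trans ::
  "'k ring \<Rightarrow> ('o, 'm, 'z) category_scheme \<Rightarrow> ('o, 'm, 'k, 'b) module_functor \<Rightarrow>
   ('o, 'm, 'k, 'c) module_functor \<Rightarrow> ('o \<Rightarrow> 'b \<Rightarrow> 'c) \<Rightarrow> bool" where
  "nat_trans R C F G \<alpha> \<longleftrightarrow>
     (\<forall>V \<in> Obj C. \<alpha> V \<in> mod_hom R (Val F V) (Val G V)) \<and>
     (\<forall>f \<in> Arr C. \<forall>x \<in> carrier (Val F (Dom C f)).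
        \<alpha> (Cod C f) (Map F f x) = Map G f (\<alpha> (Dom C f) x))"

text \<open>\<open>left_kan_extension TYPE('c) R B C F L \<eta>\<close>: for a full subcategory \<open>B\<close> of \<open>C\<close>, the
  \<open>C\<close>-module \<open>L\<close> with the natural transformation \<open>\<eta>\<close> from \<open>F\<close> to the restriction of \<open>L\<close> to \<open>B\<close>
  is a left Kan extension of the \<open>B\<close>-module \<open>F\<close> along the inclusion of \<open>B\<close>, where the universal
  property is tested on modules with elements in \<open>'c\<close>.  As a functor on \<open>B\<close>, the restriction of
  a \<open>C\<close>-module is given by the same data as the module itself.  If \<open>F\<close> and \<open>L\<close> have elements in
  \<open>'b\<close> and \<open>C\<close> has arrows in \<open>'m\<close>, then testing on \<open>'m \<Rightarrow> 'b\<close> implies the universal property for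
  modules with elements in any type: see lemma \<open>left_kan_extension_any_type\<close> below.\<close>

definition left_kan_extension ::
  "'c itself \<Rightarrow> 'k ring \<Rightarrow> ('o, 'm, 'z) category_scheme \<Rightarrow> ('o, 'm, 'z) category_scheme \<Rightarrow>
   ('o, 'm, 'k, 'b) module_functor \<Rightarrow> ('o, 'm, 'k, 'l) module_functor \<Rightarrow> ('o \<Rightarrow> 'b \<Rightarrow> 'l) \<Rightarrow> bool"
  where
  "left_kan_extension _ R B C F L \<eta> \<longleftrightarrow>
     cat_module R B F \<and> cat_module R C L \<and> nat_trans R B F L \<eta> \<and>
     (\<forall>(G :: ('o, 'm, 'k, 'c) module_functor) \<gamma>. cat_module R C G \<and> nat_trans R B F G \<gamma> \<longrightarrow>
        (\<exists>\<beta>. nat_trans R C L G \<beta> \<and>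
           (\<forall>V \<in> Obj B. \<forall>x \<in> carrier (Val F V). \<beta> V (\<eta> V x) = \<gamma> V x)) \<and>
        (\<forall>\<beta> \<beta>'. nat_trans R C L G \<beta> \<and> nat_trans R C L G \<beta>' \<and>
           (\<forall>V \<in> Obj B. \<forall>x \<in> carrier (Val F V). \<beta> V (\<eta> V x) = \<gamma> V x) \<and>
           (\<forall>V \<in> Obj B. \<forall>x \<in> carrier (Val F V). \<beta>' V (\<eta> V x) = \<gamma> V x) \<longrightarrow>
           (\<forall>V \<in> Obj C. \<forall>x \<in> carrier (Val L V). \<beta> V x = \<beta>' V x)))"


section \<open>Independence of the types of module elements\<close>

lemma mod_homD:
  assumes "h \<in> mod_hom R P Q"
  shows "x \<in> carrier P \<Longrightarrow> h x \<in> carrier Q"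
    and "x \<in> carrier P \<Longrightarrow> y \<in> carrier P \<Longrightarrow> h (x \<oplus>\<^bsub>P\<^esub> y) = h x \<oplus>\<^bsub>Q\<^esub> h y"
    and "a \<in> carrier R \<Longrightarrow> x \<in> carrier P \<Longrightarrow> h (a \<odot>\<^bsub>P\<^esub> x) = a \<odot>\<^bsub>Q\<^esub> h x"
  using assms by (auto simp: mod_hom_def)

lemma mod_hom_zero:
  assumes "module R P" "module R Q" "h \<in> mod_hom R P Q"
  shows "h \<zero>\<^bsub>P\<^esub> = \<zero>\<^bsub>Q\<^esub>"
proof -
  interpret P: module R P by fact
  interpret Q: module R Q by fact
  have "h (\<zero>\<^bsub>R\<^esub> \<odot>\<^bsub>P\<^esub> \<zero>\<^bsub>P\<^esub>) = \<zero>\<^bsub>R\<^esub> \<odot>\<^bsub>Q\<^esub> h \<zero>\<^bsub>P\<^esub>"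
    using mod_homD(3)[OF assms(3)] by blast
  then show ?thesis
    using mod_homD(1)[OF assms(3)] by simp
qed

lemma (in module) submoduleI':
  assumes "H \<subseteq> carrier M" "\<zero>\<^bsub>M\<^esub> \<in> H"
    and "\<And>a b. \<lbrakk>a \<in> H; b \<in> H\<rbrakk> \<Longrightarrow> a \<oplus>\<^bsub>M\<^esub> b \<in> H"
    and "\<And>a x. \<lbrakk>a \<in> carrier R; x \<in> H\<rbrakk> \<Longrightarrow> a \<odot>\<^bsub>M\<^esub> x \<in> H"
  shows "submodule H R M"
proof (rule submoduleI)
  fix a assume a: "a \<in> H"
  then have c: "a \<in> carrier M" using assms(1) by auto
  have "(\<ominus> \<one>) \<odot>\<^bsub>M\<^esub> a \<in> H" by (rule assms(4)) (use a in auto)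
  then show "\<ominus>\<^bsub>M\<^esub> a \<in> H" using c by (simp add: smult_l_minus)
qed (use assms in auto)

lemma submodule_zero:
  assumes "submodule H R P" shows "\<zero>\<^bsub>P\<^esub> \<in> H"
  using subgroup.one_closed[OF submodule.axioms(1)[OF assms]] by simp

lemma submodule_closed:
  assumes "module R P" "submodule H R P"
  shows "H \<subseteq> carrier P" "x \<in> H \<Longrightarrow> y \<in> H \<Longrightarrow> x \<oplus>\<^bsub>P\<^esub> y \<in> H"
    "a \<in> carrier R \<Longrightarrow> x \<in> H \<Longrightarrow> a \<odot>\<^bsub>P\<^esub> x \<in> H"
  using module.submoduleE[OF assms] by auto

lemma submodule_preimage:
  assumes P: "module R P" and Q: "module R Q" and h: "h \<in> mod_hom R P Q"
    and H: "submodule H R Q"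
  shows "submodule {x \<in> carrier P. h x \<in> H} R P"
proof -
  interpret P: module R P by fact
  show ?thesis
    by (rule P.submoduleI')
      (auto simp: mod_homD[OF h] mod_hom_zero[OF P Q h] submodule_zero[OF H] submodule_closed[OF Q H])
qed

lemma submodule_image:
  assumes P: "module R P" and Q: "module R Q" and h: "h \<in> mod_hom R P Q"
    and H: "submodule H R P"
  shows "submodule (h ` H) R Q"
proof -
  interpret Q: module R Q by fact
  note cl = submodule_closed[OF P H]
  show ?thesis
  proof (rule Q.submoduleI')
    show "h ` H \<subseteq> carrier Q" using cl(1) mod_homD(1)[OF h] by auto
    show "\<zero>\<^bsub>Q\<^esub> \<in> h ` H" using mod_hom_zero[OF P Q h] submodule_zero[OF H] by (metis imageI)
  next
    fix a b assume "a \<in> h ` H" "b \<in> h ` H"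
    then obtain x y where "x \<in> H" "y \<in> H" "a = h x" "b = h y" by auto
    then show "a \<oplus>\<^bsub>Q\<^esub> b \<in> h ` H"
      using mod_homD(2)[OF h, of x y] cl by (metis imageI subsetD)
  next
    fix a b assume "a \<in> carrier R" "b \<in> h ` H"
    then obtain y where "y \<in> H" "b = h y" by auto
    then show "a \<odot>\<^bsub>Q\<^esub> b \<in> h ` H"
      using mod_homD(3)[OF h, of a y] cl \<open>a \<in> carrier R\<close> by (metis imageI subsetD)
  qed
qed

lemma mod_span_module:
  assumes P: "module R P" and "Z \<subseteq> carrier P"
  shows "submodule (mod_span R P Z) R P" "Z \<subseteq> mod_span R P Z"
    "submodule H R P \<Longrightarrow> Z \<subseteq> H \<Longrightarrow> mod_span R P Z \<subseteq> H"
proof -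
  interpret P: module R P by fact
  have c: "submodule (carrier P) R P" by (rule P.carrier_is_submodule)
  show "submodule (mod_span R P Z) R P"
    by (rule P.submoduleI')
      (use c assms(2) in \<open>auto simp: mod_span_def submodule_zero submodule_closed[OF P]\<close>)
qed (auto simp: mod_span_def)

lemma cat_submoduleD:
  assumes "cat_submodule R C M S"
  shows "V \<in> Obj C \<Longrightarrow> submodule (S V) R (Val M V)"
    "f \<in> Arr C \<Longrightarrow> x \<in> S (Dom C f) \<Longrightarrow> Map M f x \<in> S (Cod C f)"
  using assms by (auto simp: cat_submodule_def)

context cat_module begin

lemma Map_hom': "f \<in> Arr C \<Longrightarrow> Map M f \<in> mod_hom R (Val M (Dom C f)) (Val M (Cod C f))"
  using Map_hom by (auto simp: Hom_def)

lemma sub_functor_module: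
  assumes S: "cat_submodule R C M S"
  shows "cat_module R C (sub_functor M S)"
proof -
  note sub = cat_submoduleD(1)[OF S]
  have c: "V \<in> Obj C \<Longrightarrow> S V \<subseteq> carrier (Val M V)" for V
    using submodule_closed(1)[OF Val_module sub] .
  show ?thesis
  proof (intro cat_module.intro cat_module_axioms.intro is_cring category_axioms, goal_cases)
    case (1 V)
    then show ?case
      using submodule.submodule_is_module[OF sub Val_module] by (simp add: sub_functor_def)
  next
    case (2 f V W)
    then have f: "f \<in> Arr C" "V = Dom C f" "W = Cod C f" by (auto simp: Hom_def)
    show ?case
      using mod_homD[OF Map_hom'[OF f(1)]] cat_submoduleD(2)[OF S f(1)] c[OF Dom_Obj[OF f(1)]]
      by (auto simp: sub_functor_def mod_hom_def f(2,3) subset_iff)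
  next
    case (3 V x)
    then show ?case using c Map_Ide by (auto simp: sub_functor_def)
  next
    case (4 f U V g W x)
    then have "U \<in> Obj C" using Dom_Obj by (auto simp: Hom_def)
    then show ?case using 4 subsetD[OF c] Map_comp[OF 4(1,2)] by (auto simp: sub_functor_def)
  qed
qed

lemma carrier_cat_submodule: "cat_submodule R C M (\<lambda>V. carrier (Val M V))"
  unfolding cat_submodule_def
  using module.carrier_is_submodule[OF Val_module] mod_homD(1)[OF Map_hom'] by auto

end

lemma fin_generated_iff:
  assumes "cat_module R C M"
  shows "fin_generated R C M \<longleftrightarrow>
     (\<exists>G. finite G \<and> (\<forall>(U, x) \<in> G. U \<in> Obj C \<and> x \<in> carrier (Val M U)) \<and>
        (\<forall>S. cat_submodule R C M S \<longrightarrow> (\<forall>(U, x) \<in> G. x \<in> S U) \<longrightarrow>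
           (\<forall>V \<in> Obj C. carrier (Val M V) \<subseteq> S V)))"
proof -
  interpret cat_module R C M by fact
  have eq: "(\<forall>V \<in> Obj C. generated_by R C M G V = carrier (Val M V)) \<longleftrightarrow>
    (\<forall>S. cat_submodule R C M S \<longrightarrow> (\<forall>(U, x) \<in> G. x \<in> S U) \<longrightarrow>
           (\<forall>V \<in> Obj C. carrier (Val M V) \<subseteq> S V))"
    if G: "\<forall>(U, x) \<in> G. U \<in> Obj C \<and> x \<in> carrier (Val M U)" for G
  proof -
    have sub: "generated_by R C M G V \<subseteq> carrier (Val M V)" if "V \<in> Obj C" for V
      unfolding generated_by_def using carrier_cat_submodule G by blast
    show ?thesis
    proof
      assume *: "\<forall>V \<in> Obj C. generated_by R C M G V = carrier (Val M V)"
      show "\<forall>S. cat_submodule R C M S \<longrightarrow> (\<forall>(U, x) \<in> G. x \<in> S U) \<longrightarrow>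
           (\<forall>V \<in> Obj C. carrier (Val M V) \<subseteq> S V)"
      proof (intro allI impI ballI)
        fix S V assume "cat_submodule R C M S" "\<forall>(U, x) \<in> G. x \<in> S U" "V \<in> Obj C"
        then have "generated_by R C M G V \<subseteq> S V" unfolding generated_by_def by blast
        then show "carrier (Val M V) \<subseteq> S V" using * \<open>V \<in> Obj C\<close> by simp
      qed
    next
      assume *: "\<forall>S. cat_submodule R C M S \<longrightarrow> (\<forall>(U, x) \<in> G. x \<in> S U) \<longrightarrow>
           (\<forall>V \<in> Obj C. carrier (Val M V) \<subseteq> S V)"
      show "\<forall>V \<in> Obj C. generated_by R C M G V = carrier (Val M V)"
      proof (intro ballI subset_antisym)
        fix V assume "V \<in> Obj C"
        then show "carrier (Val M V) \<subseteq> generated_by R C M G V"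
          unfolding generated_by_def using * by blast
      qed (rule sub)
    qed
  qed
  show ?thesis
    unfolding fin_generated_def by (intro iff_exI conj_cong refl eq)
qed

lemma fin_generatedE:
  assumes "cat_module R C M" "fin_generated R C M"
  obtains G where "finite G" "\<And>U x. (U, x) \<in> G \<Longrightarrow> U \<in> Obj C \<and> x \<in> carrier (Val M U)"
    "\<And>S V. cat_submodule R C M S \<Longrightarrow> (\<forall>(U, x) \<in> G. x \<in> S U) \<Longrightarrow> V \<in> Obj C \<Longrightarrow>
       carrier (Val M V) \<subseteq> S V"
proof -
  from assms(2)[unfolded fin_generated_iff[OF assms(1)]] obtain G where
    G: "finite G" "\<forall>(U, x) \<in> G. U \<in> Obj C \<and> x \<in> carrier (Val M U)"
    "\<forall>S. cat_submodule R C M S \<longrightarrow> (\<forall>(U, x) \<in> G. x \<in> S U) \<longrightarrow>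
           (\<forall>V \<in> Obj C. carrier (Val M V) \<subseteq> S V)"
    by (elim exE conjE)
  show thesis
    by (rule that[OF G(1)]) (use G(2) in force, use G(3) in metis)
qed

lemma cat_submodule_preimage:
  assumes M: "cat_module R C M" and N: "cat_module R C N" and \<phi>: "nat_trans R C M N \<phi>"
    and S: "cat_submodule R C N S"
  shows "cat_submodule R C M (\<lambda>V. {x \<in> carrier (Val M V). \<phi> V x \<in> S V})"
  unfolding cat_submodule_def
proof (intro conjI ballI)
  interpret M: cat_module R C M by fact
  interpret N: cat_module R C N by fact
  show "submodule {x \<in> carrier (Val M V). \<phi> V x \<in> S V} R (Val M V)" if "V \<in> Obj C" for V
    using that \<phi> cat_submoduleD(1)[OF S]
    by (intro submodule_preimage[OF M.Val_module N.Val_module]) (auto simp: nat_trans_def)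
  show "Map M f ` {x \<in> carrier (Val M (Dom C f)). \<phi> (Dom C f) x \<in> S (Dom C f)}
    \<subseteq> {x \<in> carrier (Val M (Cod C f)). \<phi> (Cod C f) x \<in> S (Cod C f)}" if "f \<in> Arr C" for f
    using that \<phi> cat_submoduleD(2)[OF S that] mod_homD(1)[OF M.Map_hom'[OF that]]
    by (auto simp: nat_trans_def)
qed

lemma cat_submodule_image:
  assumes M: "cat_module R C M" and N: "cat_module R C N" and \<phi>: "nat_trans R C M N \<phi>"
    and S: "cat_submodule R C M S"
  shows "cat_submodule R C N (\<lambda>V. \<phi> V ` S V)"
  unfolding cat_submodule_def
proof (intro conjI ballI)
  interpret M: cat_module R C M by fact
  interpret N: cat_module R C N by fact
  show "submodule (\<phi> V ` S V) R (Val N V)" if "V \<in> Obj C" for V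
    using that \<phi> cat_submoduleD(1)[OF S]
    by (intro submodule_image[OF M.Val_module N.Val_module]) (auto simp: nat_trans_def)
  show "Map N f ` \<phi> (Dom C f) ` S (Dom C f) \<subseteq> \<phi> (Cod C f) ` S (Cod C f)" if f: "f \<in> Arr C" for f
  proof -
    have "S (Dom C f) \<subseteq> carrier (Val M (Dom C f))"
      using submodule_closed(1)[OF M.Val_module cat_submoduleD(1)[OF S]] M.Dom_Obj[OF f] by auto
    moreover have "\<phi> (Cod C f) (Map M f x) = Map N f (\<phi> (Dom C f) x)"
      if "x \<in> carrier (Val M (Dom C f))" for x
      using \<phi> f that by (auto simp: nat_trans_def)
    ultimately show ?thesis
      using cat_submoduleD(2)[OF S f] by (auto intro!: image_eqI dest: sym subsetD)
  qed
qed

lemma fin_generated_surj: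
  assumes M: "cat_module R C M" and N: "cat_module R C N" and \<phi>: "nat_trans R C M N \<phi>"
    and surj: "\<And>V. V \<in> Obj C \<Longrightarrow> carrier (Val N V) \<subseteq> \<phi> V ` carrier (Val M V)"
    and fg: "fin_generated R C M"
  shows "fin_generated R C N"
proof -
  obtain G where G: "finite G" "\<And>U x. (U, x) \<in> G \<Longrightarrow> U \<in> Obj C \<and> x \<in> carrier (Val M U)"
    "\<And>S V. cat_submodule R C M S \<Longrightarrow> (\<forall>(U, x) \<in> G. x \<in> S U) \<Longrightarrow> V \<in> Obj C \<Longrightarrow>
       carrier (Val M V) \<subseteq> S V"
    by (rule fin_generatedE[OF M fg]) (rule that; iprover)
  let ?H = "(\<lambda>(U, x). (U, \<phi> U x)) ` G"
  have "\<forall>(U, y) \<in> ?H. U \<in> Obj C \<and> y \<in> carrier (Val N U)"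
    using G(2) \<phi> mod_homD(1) unfolding nat_trans_def by fastforce
  moreover have "carrier (Val N V) \<subseteq> S V"
    if S: "cat_submodule R C N S" and H: "\<forall>(U, y) \<in> ?H. y \<in> S U" and V: "V \<in> Obj C" for S V
  proof -
    have "carrier (Val M V) \<subseteq> {x \<in> carrier (Val M V). \<phi> V x \<in> S V}"
      by (rule G(3)[OF cat_submodule_preimage[OF M N \<phi> S] _ V]) (use G(2) H in auto)
    then show ?thesis using surj[OF V] by auto
  qed
  ultimately show ?thesis
    unfolding fin_generated_iff[OF N] using G(1) by (intro exI[of _ ?H] conjI allI impI ballI) auto
qed

definition transport_val :: "('b \<Rightarrow> 'u) \<Rightarrow> ('k, 'b) module \<Rightarrow> ('k, 'u) module" where
  "transport_val e P = \<lparr>carrier = e ` carrier P, monoid.mult = (\<lambda>_ _. undefined), one = undefined,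
     zero = e \<zero>\<^bsub>P\<^esub>,
     add = (\<lambda>x y. e (inv_into (carrier P) e x \<oplus>\<^bsub>P\<^esub> inv_into (carrier P) e y)),
     smult = (\<lambda>a x. e (a \<odot>\<^bsub>P\<^esub> inv_into (carrier P) e x))\<rparr>"

definition transport ::
  "('o, 'm, 'z) category_scheme \<Rightarrow> ('o \<Rightarrow> 'b \<Rightarrow> 'u) \<Rightarrow> ('o, 'm, 'k, 'b) module_functor \<Rightarrow>
   ('o, 'm, 'k, 'u) module_functor" where
  "transport C e M = \<lparr>Val = (\<lambda>V. transport_val (e V) (Val M V)),
     Map = (\<lambda>f x. e (Cod C f) (Map M f (inv_into (carrier (Val M (Dom C f))) (e (Dom C f)) x)))\<rparr>"

lemma transport_val_module:
  assumes P: "module R P" and e: "inj_on e (carrier P)"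
  shows "module R (transport_val e P)" "e \<in> mod_hom R P (transport_val e P)"
    "inv_into (carrier P) e \<in> mod_hom R (transport_val e P) P"
proof -
  interpret P: module R P by fact
  note i = inv_into_f_f[OF e]
  show "module R (transport_val e P)"
  proof (rule moduleI)
    show "abelian_group (transport_val e P)"
    proof (rule abelian_groupI, goal_cases)
      case (6 x)
      then obtain p where "p \<in> carrier P" "x = e p" by (auto simp: transport_val_def)
      then show ?case by (auto simp: transport_val_def i P.M.l_neg intro!: bexI[of _ "\<ominus>\<^bsub>P\<^esub> p"])
    qed (auto simp: transport_val_def i P.M.a_ac)
  qed (auto simp: transport_val_def i P.is_cring P.smult_l_distr P.smult_r_distr P.smult_assoc1)
  show "e \<in> mod_hom R P (transport_val e P)"
    "inv_into (carrier P) e \<in> mod_hom R (transport_val e P) P"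
    by (auto simp: mod_hom_def transport_val_def i)
qed

lemma transport_module:
  assumes M: "cat_module R C M" and e: "\<And>V. V \<in> Obj C \<Longrightarrow> inj_on (e V) (carrier (Val M V))"
  shows "cat_module R C (transport C e M)" "nat_trans R C M (transport C e M) e"
    "nat_trans R C (transport C e M) M (\<lambda>V. inv_into (carrier (Val M V)) (e V))"
proof -
  interpret cat_module R C M by fact
  let ?i = "\<lambda>V. inv_into (carrier (Val M V)) (e V)"
  have i: "?i V (e V x) = x" if "V \<in> Obj C" "x \<in> carrier (Val M V)" for V x
    using inv_into_f_f[OF e] that by auto
  have Val: "Val (transport C e M) V = transport_val (e V) (Val M V)" for V
    by (simp add: transport_def)
  have car: "carrier (Val (transport C e M) V) = e V ` carrier (Val M V)" for V
    by (simp add: transport_def transport_val_def)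
  note tv = transport_val_module[OF Val_module e]
  have Map: "Map (transport C e M) f (e V x) = e W (Map M f x)"
    if "f \<in> Hom C V W" "x \<in> carrier (Val M V)" for f V W x
    using that i Dom_Obj by (auto simp: Hom_def transport_def)
  have HO: "V \<in> Obj C \<and> W \<in> Obj C" if "f \<in> Hom C V W" for f V W
    using that Dom_Obj Cod_Obj by (auto simp: Hom_def)
  show "cat_module R C (transport C e M)"
  proof (intro cat_module.intro cat_module_axioms.intro is_cring category_axioms, goal_cases)
    case (1 V)
    then show ?case using tv(1) by (simp add: Val)
  next
    case (2 f V W)
    note O = HO[OF 2]
    note h = mod_homD[OF Map_hom[OF 2]]
    note t = mod_homD[OF tv(2)]
    interpret V: module R "Val M V" using O Val_module by auto
    show ?case unfolding mod_hom_def
    proof (intro CollectI conjI ballI funcsetI)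
      fix x assume "x \<in> carrier (Val (transport C e M) V)"
      then obtain p where p: "p \<in> carrier (Val M V)" "x = e V p" by (auto simp: car)
      show "Map (transport C e M) f x \<in> carrier (Val (transport C e M) W)"
        using p h(1) by (auto simp: car Map[OF 2])
      show "Map (transport C e M) f (a \<odot>\<^bsub>Val (transport C e M) V\<^esub> x) =
        a \<odot>\<^bsub>Val (transport C e M) W\<^esub> Map (transport C e M) f x" if "a \<in> carrier R" for a
        using p h that O by (simp add: Map[OF 2] Val t(3)[symmetric])
      fix y assume "y \<in> carrier (Val (transport C e M) V)"
      then obtain q where q: "q \<in> carrier (Val M V)" "y = e V q" by (auto simp: car)
      show "Map (transport C e M) f (x \<oplus>\<^bsub>Val (transport C e M) V\<^esub> y) =
        Map (transport C e M) f x \<oplus>\<^bsub>Val (transport C e M) W\<^esub> Map (transport C e M) f y"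
        using p q h O by (simp add: Map[OF 2] Val t(2)[symmetric])
    qed
  next
    case (3 V x)
    then show ?case using Map[OF Ide_Hom] Map_Ide by (auto simp: car)
  next
    case (4 f U V g W x)
    then show ?case
      using Map[OF 4(1)] Map[OF 4(2)] Map[OF comp_Hom[OF 4(1,2)]] Map_comp[OF 4(1,2)]
        mod_homD(1)[OF Map_hom[OF 4(1)]]
      by (auto simp: car)
  qed
  show "nat_trans R C M (transport C e M) e"
    unfolding nat_trans_def using tv(2) Map by (auto simp: Val Hom_def)
  show "nat_trans R C (transport C e M) M ?i"
    unfolding nat_trans_def
  proof (intro conjI ballI)
    fix f x assume f: "f \<in> Arr C" and "x \<in> carrier (Val (transport C e M) (Dom C f))"
    then obtain p where p: "p \<in> carrier (Val M (Dom C f))" "x = e (Dom C f) p" by (auto simp: car)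
    have fH: "f \<in> Hom C (Dom C f) (Cod C f)" using f by (simp add: Hom_def)
    show "?i (Cod C f) (Map (transport C e M) f x) = Map M f (?i (Dom C f) x)"
      using p HO[OF fH] mod_homD(1)[OF Map_hom[OF fH]] by (simp add: Map[OF fH] i)
  qed (use tv(3) in \<open>simp add: Val\<close>)
qed

lemma sub_transport_nat:
  assumes N: "nat_trans R C M N \<phi>" and S: "\<And>V. V \<in> Obj C \<Longrightarrow> S V \<subseteq> carrier (Val M V)"
    and T: "\<And>V. V \<in> Obj C \<Longrightarrow> \<phi> V ` S V \<subseteq> T V" and C: "category C"
  shows "nat_trans R C (sub_functor M S) (sub_functor N T) \<phi>"
  using N S T category.Dom_Obj[OF C]
  unfolding nat_trans_def mod_hom_def sub_functor_def
  by (auto simp: subset_iff image_subset_iff Pi_iff)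

lemma sum_rep:
  assumes P: "module R P" and L: "\<And>i. i \<in> I \<Longrightarrow> submodule (L i) R P"
    and x: "x \<in> mod_span R P (\<Union>i\<in>I. L i)"
  shows "\<exists>l. (\<forall>i\<in>I. l i \<in> L i) \<and> finite {i \<in> I. l i \<noteq> \<zero>\<^bsub>P\<^esub>} \<and>
    x = finsum P l {i \<in> I. l i \<noteq> \<zero>\<^bsub>P\<^esub>}"
proof -
  interpret P: module R P by fact
  let ?H = "{x. \<exists>l. (\<forall>i\<in>I. l i \<in> L i) \<and> finite {i \<in> I. l i \<noteq> \<zero>\<^bsub>P\<^esub>} \<and>
    x = finsum P l {i \<in> I. l i \<noteq> \<zero>\<^bsub>P\<^esub>}}"
  have Lc: "i \<in> I \<Longrightarrow> L i \<subseteq> carrier P" for i using submodule_closed(1)[OF P L] .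
  have ext: "finsum P l {i \<in> I. l i \<noteq> \<zero>\<^bsub>P\<^esub>} = finsum P l F"
    if "\<forall>i\<in>I. l i \<in> L i" "finite F" "F \<subseteq> I" "{i \<in> I. l i \<noteq> \<zero>\<^bsub>P\<^esub>} \<subseteq> F" for l F
    by (rule P.M.add.finprod_mono_neutral_cong_left[OF that(2,4)])
      (use that subsetD[OF Lc] in auto)
  have "submodule ?H R P"
  proof (rule P.submoduleI')
    show "?H \<subseteq> carrier P" using Lc by (auto intro!: P.M.finsum_closed)
    show "\<zero>\<^bsub>P\<^esub> \<in> ?H" using submodule_zero[OF L] by (auto intro!: exI[of _ "\<lambda>_. \<zero>\<^bsub>P\<^esub>"])
  next
    fix a b assume "a \<in> ?H" "b \<in> ?H"
    then obtain l k where l: "\<forall>i\<in>I. l i \<in> L i" "finite {i \<in> I. l i \<noteq> \<zero>\<^bsub>P\<^esub>}"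
        "a = finsum P l {i \<in> I. l i \<noteq> \<zero>\<^bsub>P\<^esub>}"
      and k: "\<forall>i\<in>I. k i \<in> L i" "finite {i \<in> I. k i \<noteq> \<zero>\<^bsub>P\<^esub>}"
        "b = finsum P k {i \<in> I. k i \<noteq> \<zero>\<^bsub>P\<^esub>}" by auto
    let ?F = "{i \<in> I. l i \<noteq> \<zero>\<^bsub>P\<^esub>} \<union> {i \<in> I. k i \<noteq> \<zero>\<^bsub>P\<^esub>}"
    let ?m = "\<lambda>i. l i \<oplus>\<^bsub>P\<^esub> k i"
    have m: "\<forall>i\<in>I. ?m i \<in> L i" using l(1) k(1) submodule_closed(2)[OF P L] by auto
    have s: "{i \<in> I. ?m i \<noteq> \<zero>\<^bsub>P\<^esub>} \<subseteq> ?F" by auto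
    have "a = finsum P l ?F" "b = finsum P k ?F"
      using ext[of l ?F] ext[of k ?F] l k by auto
    then have "a \<oplus>\<^bsub>P\<^esub> b = finsum P ?m ?F"
      using l(1) k(1) Lc by (subst P.M.finsum_addf) auto
    also have "\<dots> = finsum P ?m {i \<in> I. ?m i \<noteq> \<zero>\<^bsub>P\<^esub>}"
      by (rule ext[symmetric]) (use l k m s in auto)
    finally show "a \<oplus>\<^bsub>P\<^esub> b \<in> ?H"
      using m s finite_subset[OF s] l(2) k(2) by (auto intro!: exI[of _ ?m])
  next
    fix a x assume a: "a \<in> carrier R" and "x \<in> ?H"
    then obtain l where l: "\<forall>i\<in>I. l i \<in> L i" "finite {i \<in> I. l i \<noteq> \<zero>\<^bsub>P\<^esub>}"
        "x = finsum P l {i \<in> I. l i \<noteq> \<zero>\<^bsub>P\<^esub>}" by auto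
    let ?F = "{i \<in> I. l i \<noteq> \<zero>\<^bsub>P\<^esub>}"
    let ?m = "\<lambda>i. a \<odot>\<^bsub>P\<^esub> l i"
    have m: "\<forall>i\<in>I. ?m i \<in> L i" using l(1) a submodule_closed(3)[OF P L] by auto
    have s: "{i \<in> I. ?m i \<noteq> \<zero>\<^bsub>P\<^esub>} \<subseteq> ?F" using a by auto
    have "a \<odot>\<^bsub>P\<^esub> x = finsum P ?m ?F"
      unfolding l(3) by (rule P.finsum_smult_ldistr) (use a l Lc in auto)
    also have "\<dots> = finsum P ?m {i \<in> I. ?m i \<noteq> \<zero>\<^bsub>P\<^esub>}"
      by (rule ext[symmetric]) (use l m s in auto)
    finally show "a \<odot>\<^bsub>P\<^esub> x \<in> ?H"
      using m s finite_subset[OF s] l(2) by (auto intro!: exI[of _ ?m])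
  qed
  moreover have "(\<Union>i\<in>I. L i) \<subseteq> ?H"
  proof clarify
    fix j y assume j: "j \<in> I" and y: "y \<in> L j"
    let ?l = "\<lambda>i. if i = j then y else \<zero>\<^bsub>P\<^esub>"
    have l: "\<forall>i\<in>I. ?l i \<in> L i" using y submodule_zero[OF L] by auto
    have "finsum P ?l {i \<in> I. ?l i \<noteq> \<zero>\<^bsub>P\<^esub>} = finsum P ?l {j}"
      by (rule ext) (use l j in auto)
    also have "\<dots> = y" using y Lc[OF j] by (simp add: subsetD)
    finally show "\<exists>l. (\<forall>i\<in>I. l i \<in> L i) \<and> finite {i \<in> I. l i \<noteq> \<zero>\<^bsub>P\<^esub>} \<and>
      y = finsum P l {i \<in> I. l i \<noteq> \<zero>\<^bsub>P\<^esub>}"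
      using l by (intro exI[of _ ?l]) auto
  qed
  ultimately show ?thesis
    using x unfolding mod_span_def by blast
qed

lemma sum_inj:
  fixes h :: "'i \<Rightarrow> 'c \<Rightarrow> 'b"
  assumes P: "module R P" and L: "\<And>i. i \<in> I \<Longrightarrow> submodule (h i ` K i) R P"
  shows "\<exists>e :: 'b \<Rightarrow> 'i \<Rightarrow> 'c. inj_on e (mod_span R P (\<Union>i\<in>I. h i ` K i))"
proof -
  let ?Q = "\<lambda>x l. (\<forall>i\<in>I. l i \<in> h i ` K i) \<and> x = finsum P l {i \<in> I. l i \<noteq> \<zero>\<^bsub>P\<^esub>}"
  define l where "l x = (SOME l. ?Q x l)" for x
  have l: "?Q x (l x)" if x: "x \<in> mod_span R P (\<Union>i\<in>I. h i ` K i)" for x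
  proof -
    have "\<exists>l. ?Q x l" using sum_rep[of R P I "\<lambda>i. h i ` K i", OF P L x] by auto
    from someI_ex[OF this] show ?thesis unfolding l_def .
  qed
  have "inj_on (\<lambda>x i. inv_into (K i) (h i) (l x i)) (mod_span R P (\<Union>i\<in>I. h i ` K i))"
  proof (rule inj_onI)
    interpret P: module R P by fact
    fix x y assume x: "x \<in> mod_span R P (\<Union>i\<in>I. h i ` K i)"
      and y: "y \<in> mod_span R P (\<Union>i\<in>I. h i ` K i)"
      and eq: "(\<lambda>i. inv_into (K i) (h i) (l x i)) = (\<lambda>i. inv_into (K i) (h i) (l y i))"
    have same: "l x i = l y i" if i: "i \<in> I" for i
    proof -
      have "l x i \<in> h i ` K i" "l y i \<in> h i ` K i" using l[OF x] l[OF y] i by simp_all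
      moreover have "inv_into (K i) (h i) (l x i) = inv_into (K i) (h i) (l y i)"
        by (rule fun_cong[OF eq])
      ultimately show ?thesis by (rule inv_into_injective[rotated])
    qed
    have "l y i \<in> carrier P" if i: "i \<in> I" for i
      using subsetD[OF submodule_closed(1)[OF P L[OF i]]] l[OF y] i by simp
    then have "finsum P (l x) {i \<in> I. l x i \<noteq> \<zero>\<^bsub>P\<^esub>} = finsum P (l y) {i \<in> I. l y i \<noteq> \<zero>\<^bsub>P\<^esub>}"
      by (intro P.M.finsum_cong') (auto simp: same)
    moreover have "x = finsum P (l x) {i \<in> I. l x i \<noteq> \<zero>\<^bsub>P\<^esub>}" using l[OF x] by (rule conjunct2)
    moreover have "y = finsum P (l y) {i \<in> I. l y i \<noteq> \<zero>\<^bsub>P\<^esub>}" using l[OF y] by (rule conjunct2)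
    ultimately show "x = y" by metis
  qed
  then show ?thesis by blast
qed

context cat_module begin

lemma span_cat_submodule:
  assumes Z: "\<And>V. V \<in> Obj C \<Longrightarrow> Z V \<subseteq> carrier (Val M V)"
    and ZM: "\<And>f. f \<in> Arr C \<Longrightarrow> Map M f ` Z (Dom C f) \<subseteq> Z (Cod C f)"
  shows "cat_submodule R C M (\<lambda>V. mod_span R (Val M V) (Z V))"
  unfolding cat_submodule_def
proof (intro conjI ballI)
  show "submodule (mod_span R (Val M V) (Z V)) R (Val M V)" if "V \<in> Obj C" for V
    using mod_span_module(1)[OF Val_module Z] that by auto
  fix f assume f: "f \<in> Arr C"
  note D = Val_module[OF Dom_Obj[OF f]] note K = Val_module[OF Cod_Obj[OF f]]
  note sp = mod_span_module[OF K Z[OF Cod_Obj[OF f]]]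
  have "mod_span R (Val M (Dom C f)) (Z (Dom C f)) \<subseteq>
    {x \<in> carrier (Val M (Dom C f)). Map M f x \<in> mod_span R (Val M (Cod C f)) (Z (Cod C f))}"
    by (rule mod_span_module(3)[OF D Z[OF Dom_Obj[OF f]]])
      (use submodule_preimage[OF D K Map_hom'[OF f] sp(1)] Z[OF Dom_Obj[OF f]] ZM[OF f] sp(2) in auto)
  then show "Map M f ` mod_span R (Val M (Dom C f)) (Z (Dom C f)) \<subseteq>
    mod_span R (Val M (Cod C f)) (Z (Cod C f))" by auto
qed

lemma fin_generated_inj:
  assumes fg: "fin_generated R C M"
  shows "\<exists>e :: 'o \<Rightarrow> 'b \<Rightarrow> (nat \<times> 'm \<Rightarrow> 'k). \<forall>V \<in> Obj C. inj_on (e V) (carrier (Val M V))"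
proof -
  have cm: "cat_module R C M" ..
  obtain G where G: "finite G" "\<And>U x. (U, x) \<in> G \<Longrightarrow> U \<in> Obj C \<and> x \<in> carrier (Val M U)"
    "\<And>S V. cat_submodule R C M S \<Longrightarrow> (\<forall>(U, x) \<in> G. x \<in> S U) \<Longrightarrow> V \<in> Obj C \<Longrightarrow>
       carrier (Val M V) \<subseteq> S V"
    by (rule fin_generatedE[OF cm fg]) (rule that; iprover)
  obtain n :: nat and g where g: "G = g ` {i. i < n}"
    using finite_imp_nat_seg_image_inj_on[OF G(1)] by auto
  have gG: "fst (g i) \<in> Obj C" "snd (g i) \<in> carrier (Val M (fst (g i)))" if "i < n" for i
    using G(2)[of "fst (g i)" "snd (g i)"] that g by auto
  let ?I = "\<lambda>V. {(i, f). i < n \<and> f \<in> Hom C (fst (g i)) V}"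
  let ?h = "\<lambda>V (i, f) a. a \<odot>\<^bsub>Val M V\<^esub> Map M f (snd (g i))"
  let ?Z = "\<lambda>V. \<Union>j \<in> ?I V. ?h V j ` carrier R"
  have mc: "Map M f (snd (g i)) \<in> carrier (Val M V)" if "(i, f) \<in> ?I V" for i f V
    using mod_homD(1)[OF Map_hom] gG that by auto
  have sub: "submodule (?h V j ` carrier R) R (Val M V)" if V: "V \<in> Obj C" and j: "j \<in> ?I V" for V j
  proof -
    interpret V: module R "Val M V" by (rule Val_module[OF V])
    obtain i f where ij: "j = (i, f)" by (cases j)
    let ?x = "Map M f (snd (g i))"
    have x: "?x \<in> carrier (Val M V)" using mc j ij by auto
    have "submodule ((\<lambda>a. a \<odot>\<^bsub>Val M V\<^esub> ?x) ` carrier R) R (Val M V)"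
    proof (rule V.submoduleI')
      show "\<zero>\<^bsub>Val M V\<^esub> \<in> (\<lambda>a. a \<odot>\<^bsub>Val M V\<^esub> ?x) ` carrier R"
        using x by (intro image_eqI[of _ _ "\<zero>\<^bsub>R\<^esub>"]) auto
    qed (use x in \<open>auto simp flip: V.smult_l_distr V.smult_assoc1\<close>)
    then show ?thesis by (simp add: ij)
  qed
  have Zc: "?Z V \<subseteq> carrier (Val M V)" if "V \<in> Obj C" for V
    using submodule_closed(1)[OF Val_module sub] that by blast
  have "cat_submodule R C M (\<lambda>V. mod_span R (Val M V) (?Z V))"
  proof (rule span_cat_submodule[OF Zc])
    fix f assume f: "f \<in> Arr C"
    then have fH: "f \<in> Hom C (Dom C f) (Cod C f)" by (simp add: Hom_def)
    show "Map M f ` ?Z (Dom C f) \<subseteq> ?Z (Cod C f)"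
    proof (rule image_subsetI)
      fix y assume "y \<in> ?Z (Dom C f)"
      then obtain i u a where i: "i < n" and u: "u \<in> Hom C (fst (g i)) (Dom C f)"
        and a: "a \<in> carrier R" and y: "y = ?h (Dom C f) (i, u) a" by auto
      have c: "Map M u (snd (g i)) \<in> carrier (Val M (Dom C f))" using mc i u by auto
      have "Map M f y = ?h (Cod C f) (i, f \<cdot>\<^bsub>C\<^esub> u) a"
        using mod_homD(3)[OF Map_hom'[OF f] a c] Map_comp[OF u fH gG(2)[OF i]] y by simp
      moreover have "(i, f \<cdot>\<^bsub>C\<^esub> u) \<in> ?I (Cod C f)" using i comp_Hom[OF u fH] by simp
      ultimately show "Map M f y \<in> ?Z (Cod C f)" using a by blast
    qed
  qed
  moreover have "\<forall>(U, x) \<in> G. x \<in> mod_span R (Val M U) (?Z U)"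
  proof clarify
    fix U x assume "(U, x) \<in> G"
    then obtain i where i: "i < n" "g i = (U, x)" using g by auto
    have U: "U \<in> Obj C" and x: "x \<in> carrier (Val M U)" using gG[OF i(1)] i(2) by auto
    interpret U: module R "Val M U" by (rule Val_module[OF U])
    have "x = ?h U (i, Ide C U) \<one>\<^bsub>R\<^esub>" using i(2) Map_Ide[OF U x] x by simp
    moreover have "(i, Ide C U) \<in> ?I U" using i Ide_Hom[OF U] by simp
    ultimately have "x \<in> ?Z U" by blast
    then show "x \<in> mod_span R (Val M U) (?Z U)" using mod_span_module(2)[OF Val_module[OF U] Zc[OF U]]
      by blast
  qed
  ultimately have all: "carrier (Val M V) \<subseteq> mod_span R (Val M V) (?Z V)" if "V \<in> Obj C" for V
    using G(3) that by blast
  have "\<exists>e :: 'b \<Rightarrow> nat \<times> 'm \<Rightarrow> 'k. inj_on e (carrier (Val M V))" if V: "V \<in> Obj C" for V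
  proof -
    have "\<exists>e :: 'b \<Rightarrow> nat \<times> 'm \<Rightarrow> 'k. inj_on e (mod_span R (Val M V) (?Z V))"
      by (rule sum_inj[of R "Val M V" "?I V" "?h V" "\<lambda>_. carrier R", OF Val_module[OF V] sub[OF V]])
    then show ?thesis using inj_on_subset[OF _ all[OF V]] by (elim exE) (rule exI)
  qed
  then show ?thesis by (intro bchoice) blast
qed

end

lemma locally_noetherian_any_type:
  fixes C :: "('o, 'm, 'z) category_scheme"
  assumes ln: "locally_noetherian TYPE('k) TYPE(nat \<times> 'm \<Rightarrow> 'k) C"
  shows "locally_noetherian TYPE('k) TYPE('b) C"
  unfolding locally_noetherian_def
proof (intro allI impI, elim conjE)
  fix R :: "'k ring" and M :: "('o, 'm, 'k, 'b) module_functor" and S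
  assume R: "noetherian_ring R" and M: "cat_module R C M" and fg: "fin_generated R C M"
    and S: "cat_submodule R C M S"
  interpret cat_module R C M by fact
  have C: "category C" ..
  obtain e :: "'o \<Rightarrow> 'b \<Rightarrow> (nat \<times> 'm \<Rightarrow> 'k)"
    where e: "\<And>V. V \<in> Obj C \<Longrightarrow> inj_on (e V) (carrier (Val M V))"
    using fin_generated_inj[OF fg] by blast
  let ?T = "transport C e M" and ?i = "\<lambda>V. inv_into (carrier (Val M V)) (e V)"
  let ?S = "\<lambda>V. e V ` S V"
  note T = transport_module[of R C M e, OF M e]
  have car: "carrier (Val ?T V) = e V ` carrier (Val M V)" for V
    by (simp add: transport_def transport_val_def)
  have Sc: "S V \<subseteq> carrier (Val M V)" if "V \<in> Obj C" for V
    by (rule submodule_closed(1)[OF Val_module[OF that] cat_submoduleD(1)[OF S that]])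
  have S': "cat_submodule R C ?T ?S" by (rule cat_submodule_image[OF M T(1,2) S])
  have "fin_generated R C ?T"
    by (rule fin_generated_surj[OF M T(1,2) _ fg]) (simp_all add: car)
  then have fgS: "fin_generated R C (sub_functor ?T ?S)"
    using ln R T(1) S' unfolding locally_noetherian_def by blast
  have iS: "?i V ` ?S V = S V" if "V \<in> Obj C" for V
    using Sc[OF that] inv_into_f_f[OF e[OF that]] by (force simp: image_image subset_iff)
  have nt: "nat_trans R C (sub_functor ?T ?S) (sub_functor M S) ?i"
    by (rule sub_transport_nat[OF T(3)]) (use Sc iS C in \<open>auto simp: car\<close>)
  show "fin_generated R C (sub_functor M S)"
    by (rule fin_generated_surj[OF cat_module.sub_functor_module[OF T(1) S']
          sub_functor_module[OF S] nt _ fgS])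
      (simp_all add: sub_functor_def iS)
qed

lemma nat_trans_comp:
  assumes "nat_trans R C F G \<alpha>" "nat_trans R C G H \<beta>"
    and "\<And>f. f \<in> Arr C \<Longrightarrow> Dom C f \<in> Obj C"
  shows "nat_trans R C F H (\<lambda>V x. \<beta> V (\<alpha> V x))"
  using assms unfolding nat_trans_def mod_hom_def by (simp add: Pi_iff)

lemma nat_trans_full_subcategory:
  assumes "nat_trans R C F G \<alpha>" "S \<subseteq> Obj C"
  shows "nat_trans R (full_subcategory C S) F G \<alpha>"
  using assms unfolding nat_trans_def full_subcategory_def by auto

lemma sub_functor_incl:
  assumes M: "cat_module R C M" and E: "cat_submodule R C M E"
  shows "nat_trans R C (sub_functor M E) M (\<lambda>V x. x)"
proof -
  interpret cat_module R C M by fact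
  have "E V \<subseteq> carrier (Val M V)" if "V \<in> Obj C" for V
    by (rule submodule_closed(1)[OF Val_module[OF that] cat_submoduleD(1)[OF E that]])
  then show ?thesis
    using Dom_Obj unfolding nat_trans_def mod_hom_def by (auto simp: sub_functor_def)
qed

lemma nat_trans_to_sub:
  assumes "nat_trans R B F M \<alpha>"
    and "\<And>V x. V \<in> Obj B \<Longrightarrow> x \<in> carrier (Val F V) \<Longrightarrow> \<alpha> V x \<in> E V"
  shows "nat_trans R B F (sub_functor M E) \<alpha>"
  using assms unfolding nat_trans_def mod_hom_def by (auto simp: sub_functor_def)

lemma equalizer_submodule:
  assumes L: "cat_module R C L" and G: "cat_module R C G"
    and \<beta>: "nat_trans R C L G \<beta>" "nat_trans R C L G \<beta>'"
  shows "cat_submodule R C L (\<lambda>V. {x \<in> carrier (Val L V). \<beta> V x = \<beta>' V x})"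
  unfolding cat_submodule_def
proof (intro conjI ballI)
  interpret L: cat_module R C L by fact
  interpret G: cat_module R C G by fact
  have h: "\<beta> V \<in> mod_hom R (Val L V) (Val G V)" "\<beta>' V \<in> mod_hom R (Val L V) (Val G V)"
    if "V \<in> Obj C" for V
    using \<beta> that by (auto simp: nat_trans_def)
  show "submodule {x \<in> carrier (Val L V). \<beta> V x = \<beta>' V x} R (Val L V)" if V: "V \<in> Obj C" for V
  proof -
    interpret V: module R "Val L V" by (rule L.Val_module[OF V])
    note z = mod_hom_zero[OF L.Val_module[OF V] G.Val_module[OF V]]
    show ?thesis
      by (rule V.submoduleI')
        (auto simp: mod_homD[OF h(1)[OF V]] mod_homD[OF h(2)[OF V]] z[OF h(1)[OF V]] z[OF h(2)[OF V]])
  qed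
  show "Map L f ` {x \<in> carrier (Val L (Dom C f)). \<beta> (Dom C f) x = \<beta>' (Dom C f) x} \<subseteq>
    {x \<in> carrier (Val L (Cod C f)). \<beta> (Cod C f) x = \<beta>' (Cod C f) x}" if "f \<in> Arr C" for f
    using that \<beta> mod_homD(1)[OF L.Map_hom'[OF that]] by (auto simp: nat_trans_def)
qed

lemma left_kan_extensionD:
  fixes F :: "('o, 'm, 'k, 'b) module_functor" and G :: "('o, 'm, 'k, 'c) module_functor"
  assumes "left_kan_extension TYPE('c) R B C F L \<eta>" "cat_module R C G" "nat_trans R B F G \<gamma>"
  shows "\<exists>\<beta>. nat_trans R C L G \<beta> \<and> (\<forall>V \<in> Obj B. \<forall>x \<in> carrier (Val F V). \<beta> V (\<eta> V x) = \<gamma> V x)"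
    and "nat_trans R C L G \<beta> \<Longrightarrow> nat_trans R C L G \<beta>' \<Longrightarrow>
      (\<And>V x. V \<in> Obj B \<Longrightarrow> x \<in> carrier (Val F V) \<Longrightarrow> \<beta> V (\<eta> V x) = \<gamma> V x) \<Longrightarrow>
      (\<And>V x. V \<in> Obj B \<Longrightarrow> x \<in> carrier (Val F V) \<Longrightarrow> \<beta>' V (\<eta> V x) = \<gamma> V x) \<Longrightarrow>
      V \<in> Obj C \<Longrightarrow> x \<in> carrier (Val L V) \<Longrightarrow> \<beta> V x = \<beta>' V x"
  using assms unfolding left_kan_extension_def by blast+

lemma left_kan_extension_generated:
  fixes C :: "('o, 'm, 'z) category_scheme" and F L :: "('o, 'm, 'k, 'b) module_functor"
  assumes B: "B = full_subcategory C S" "S \<subseteq> Obj C"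
    and kan: "left_kan_extension TYPE('m \<Rightarrow> 'b) R B C F L \<eta>"
    and E: "cat_submodule R C L E"
    and im: "\<And>V x. V \<in> S \<Longrightarrow> x \<in> carrier (Val F V) \<Longrightarrow> \<eta> V x \<in> E V"
    and V: "V \<in> Obj C"
  shows "carrier (Val L V) \<subseteq> E V"
proof
  fix x assume x: "x \<in> carrier (Val L V)"
  have F: "cat_module R B F" and L: "cat_module R C L" and \<eta>: "nat_trans R B F L \<eta>"
    using kan unfolding left_kan_extension_def by auto
  interpret L: cat_module R C L by fact
  interpret F: cat_module R B F by fact
  have BO: "Obj B = S" using B by (auto simp: full_subcategory_def)
  let ?E = "sub_functor L E"
  let ?e = "\<lambda>V :: 'o. \<lambda>x :: 'b. \<lambda>_ :: 'm. x"
  have inj: "inj_on (?e V) X" for V X by (auto simp: inj_on_def fun_eq_iff)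
  have Em: "cat_module R C ?E" by (rule L.sub_functor_module[OF E])
  have carE: "carrier (Val ?E V) = E V" for V by (simp add: sub_functor_def)
  note T = transport_module[of R C ?E ?e, OF Em inj]
  note TL = transport_module[of R C L ?e, OF L inj]
  have \<eta>E: "nat_trans R B F ?E \<eta>"
    by (rule nat_trans_to_sub[OF \<eta>]) (use im BO in auto)
  have "nat_trans R B F (transport C ?e ?E) (\<lambda>V x. ?e V (\<eta> V x))"
    by (rule nat_trans_comp[OF \<eta>E nat_trans_full_subcategory[OF T(2) B(2), folded B(1)] F.Dom_Obj])
  from left_kan_extensionD(1)[OF kan T(1) this]
  obtain \<beta> where \<beta>: "nat_trans R C L (transport C ?e ?E) \<beta>"
    "\<And>V x. V \<in> S \<Longrightarrow> x \<in> carrier (Val F V) \<Longrightarrow> \<beta> V (\<eta> V x) = ?e V (\<eta> V x)"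
    unfolding BO by blast
  let ?i = "\<lambda>V. inv_into (carrier (Val ?E V)) (?e V)"
  let ?b = "\<lambda>V x. ?i V (\<beta> V x)"
  have b: "nat_trans R C L ?E ?b"
    by (rule nat_trans_comp[OF \<beta>(1) T(3) L.Dom_Obj])
  have bL: "nat_trans R C L L ?b"
    by (rule nat_trans_comp[OF b sub_functor_incl[OF L E] L.Dom_Obj])
  have t1: "nat_trans R C L (transport C ?e L) (\<lambda>V x. ?e V (?b V x))"
    by (rule nat_trans_comp[OF bL TL(2) L.Dom_Obj])
  have n: "nat_trans R B F (transport C ?e L) (\<lambda>V x. ?e V (\<eta> V x))"
    by (rule nat_trans_comp[OF \<eta> nat_trans_full_subcategory[OF TL(2) B(2), folded B(1)] F.Dom_Obj])
  have "?e V (?b V x) = ?e V x"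
  proof (rule left_kan_extensionD(2)[OF kan TL(1) n t1 TL(2) _ _ V x])
    fix V x assume "V \<in> Obj B" "x \<in> carrier (Val F V)"
    then have "\<beta> V (\<eta> V x) = ?e V (\<eta> V x)" "\<eta> V x \<in> carrier (Val ?E V)"
      using \<beta>(2) im by (auto simp: BO carE)
    then have "?b V (\<eta> V x) = \<eta> V x"
      using inv_into_f_f[of "?e V" "carrier (Val ?E V)" "\<eta> V x", OF inj] by simp
    then show "?e V (?b V (\<eta> V x)) = ?e V (\<eta> V x)" by simp
  qed simp
  then have "?b V x = x" by (simp add: fun_eq_iff)
  moreover have bV: "?b V \<in> mod_hom R (Val L V) (Val ?E V)"
    using b V unfolding nat_trans_def by blast
  ultimately show "x \<in> E V" using mod_homD(1)[OF bV x] by (simp add: carE)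
qed

lemma left_kan_extension_any_type:
  fixes C :: "('o, 'm, 'z) category_scheme" and F L :: "('o, 'm, 'k, 'b) module_functor"
  assumes B: "B = full_subcategory C S" "S \<subseteq> Obj C"
    and kan: "left_kan_extension TYPE('m \<Rightarrow> 'b) R B C F L \<eta>"
  shows "left_kan_extension TYPE('c) R B C F L \<eta>"
proof -
  have F: "cat_module R B F" and L: "cat_module R C L" and \<eta>: "nat_trans R B F L \<eta>"
    using kan unfolding left_kan_extension_def by auto
  interpret L: cat_module R C L by fact
  interpret F: cat_module R B F by fact
  have BO: "Obj B = S" using B by (auto simp: full_subcategory_def)
  have BH: "f \<in> Hom B V W" if "f \<in> Hom C V W" "V \<in> S" "W \<in> S" for f V W
    using that B by (auto simp: full_subcategory_def Hom_def)
  have ex: "\<exists>\<beta>. nat_trans R C L G \<beta> \<and> (\<forall>V \<in> Obj B. \<forall>x \<in> carrier (Val F V). \<beta> V (\<eta> V x) = \<gamma> V x)"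
    if G: "cat_module R C G" and \<gamma>: "nat_trans R B F G \<gamma>"
    for G :: "('o, 'm, 'k, 'c) module_functor" and \<gamma>
  proof -
    interpret G: cat_module R C G by fact
    let ?I = "\<lambda>V. {f \<in> Arr C. Dom C f \<in> S \<and> Cod C f = V}"
    let ?h = "\<lambda>f x. Map G f (\<gamma> (Dom C f) x)"
    let ?K = "\<lambda>f. carrier (Val F (Dom C f))"
    let ?Z = "\<lambda>V. \<Union>f \<in> ?I V. ?h f ` ?K f"
    let ?S = "\<lambda>V. mod_span R (Val G V) (?Z V)"
    have \<gamma>h: "\<gamma> V \<in> mod_hom R (Val F V) (Val G V)" if "V \<in> S" for V
      using \<gamma> that BO by (auto simp: nat_trans_def)
    have sub: "submodule (?h f ` ?K f) R (Val G V)" if f: "f \<in> ?I V" for f V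
    proof -
      have O: "Dom C f \<in> S" "Dom C f \<in> Obj C" "V \<in> Obj C" "Dom C f \<in> Obj B"
        and fA: "f \<in> Arr C" and V: "V = Cod C f"
        using f L.Dom_Obj L.Cod_Obj BO by auto
      have "submodule (\<gamma> (Dom C f) ` ?K f) R (Val G (Dom C f))"
        by (rule submodule_image[OF F.Val_module[OF O(4)] G.Val_module[OF O(2)] \<gamma>h[OF O(1)]
              module.carrier_is_submodule[OF F.Val_module[OF O(4)]]])
      from submodule_image[OF G.Val_module[OF O(2)] G.Val_module[OF O(3)] _ this, of "Map G f"]
      show ?thesis using G.Map_hom'[OF fA] unfolding V by (simp add: image_image)
    qed
    have Zc: "?Z V \<subseteq> carrier (Val G V)" if "V \<in> Obj C" for V
      using submodule_closed(1)[OF G.Val_module[OF that] sub] by blast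
    have S: "cat_submodule R C G ?S"
    proof (rule G.span_cat_submodule[OF Zc])
      fix f assume f: "f \<in> Arr C"
      show "Map G f ` ?Z (Dom C f) \<subseteq> ?Z (Cod C f)"
      proof (rule image_subsetI)
        fix y assume "y \<in> ?Z (Dom C f)"
        then obtain u x where u: "u \<in> Arr C" "Dom C u \<in> S" "Cod C u = Dom C f" and x: "x \<in> ?K u"
          and y: "y = ?h u x" by blast
        have uf: "u \<in> Hom C (Dom C u) (Dom C f)" "f \<in> Hom C (Dom C f) (Cod C f)"
          using u f by (auto simp: Hom_def)
        have fu: "f \<cdot>\<^bsub>C\<^esub> u \<in> Hom C (Dom C u) (Cod C f)" by (rule L.comp_Hom[OF uf])
        have "Map G f y = ?h (f \<cdot>\<^bsub>C\<^esub> u) x"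
          using G.Map_comp[OF uf mod_homD(1)[OF \<gamma>h[OF u(2)] x]] fu y by (simp add: Hom_def)
        moreover have "f \<cdot>\<^bsub>C\<^esub> u \<in> ?I (Cod C f)" "x \<in> ?K (f \<cdot>\<^bsub>C\<^esub> u)"
          using fu u x by (auto simp: Hom_def)
        ultimately show "Map G f y \<in> ?Z (Cod C f)" by blast
      qed
    qed
    let ?D = "sub_functor G ?S"
    have D: "cat_module R C ?D" by (rule G.sub_functor_module[OF S])
    have carD: "carrier (Val ?D V) = ?S V" for V by (simp add: sub_functor_def)
    have "\<exists>e :: 'c \<Rightarrow> 'm \<Rightarrow> 'b. inj_on e (carrier (Val ?D V))" if V: "V \<in> Obj C" for V
      unfolding carD by (rule sum_inj[of R "Val G V" "?I V" ?h ?K, OF G.Val_module[OF V] sub])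
    then obtain e :: "'o \<Rightarrow> 'c \<Rightarrow> 'm \<Rightarrow> 'b"
      where e: "\<And>V. V \<in> Obj C \<Longrightarrow> inj_on (e V) (carrier (Val ?D V))"
      using bchoice[of "Obj C" "\<lambda>V e. inj_on e (carrier (Val ?D V))"] by blast
    note T = transport_module[of R C ?D e, OF D e]
    have \<gamma>S: "\<gamma> V x \<in> ?S V" if V: "V \<in> S" and x: "x \<in> carrier (Val F V)" for V x
    proof -
      have VC: "V \<in> Obj C" using V B(2) by auto
      have "\<gamma> V x = ?h (Ide C V) x" "Ide C V \<in> ?I V" "x \<in> ?K (Ide C V)"
        using L.Ide_Hom[OF VC] G.Map_Ide[OF VC mod_homD(1)[OF \<gamma>h[OF V] x]] V x
        by (auto simp: Hom_def)
      then have "\<gamma> V x \<in> ?Z V" by blast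
      then show ?thesis using mod_span_module(2)[OF G.Val_module[OF VC] Zc[OF VC]] by blast
    qed
    have \<gamma>D: "nat_trans R B F ?D \<gamma>"
      by (rule nat_trans_to_sub[OF \<gamma>]) (use \<gamma>S BO in auto)
    have "nat_trans R B F (transport C e ?D) (\<lambda>V x. e V (\<gamma> V x))"
      by (rule nat_trans_comp[OF \<gamma>D nat_trans_full_subcategory[OF T(2) B(2), folded B(1)] F.Dom_Obj])
    from left_kan_extensionD(1)[OF kan T(1) this]
    obtain \<beta> where \<beta>: "nat_trans R C L (transport C e ?D) \<beta>"
      "\<And>V x. V \<in> Obj B \<Longrightarrow> x \<in> carrier (Val F V) \<Longrightarrow> \<beta> V (\<eta> V x) = e V (\<gamma> V x)"
      by blast
    let ?b = "\<lambda>V x. inv_into (carrier (Val ?D V)) (e V) (\<beta> V x)"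
    have "nat_trans R C L G ?b"
      by (rule nat_trans_comp[OF nat_trans_comp[OF \<beta>(1) T(3) L.Dom_Obj]
            sub_functor_incl[OF G S] L.Dom_Obj])
    moreover have "?b V (\<eta> V x) = \<gamma> V x" if "V \<in> Obj B" "x \<in> carrier (Val F V)" for V x
      using \<beta>(2)[OF that] inv_into_f_f[OF e, of V "\<gamma> V x"] \<gamma>S that B(2) BO
      by (auto simp: carD)
    ultimately show ?thesis by (intro exI[of _ ?b] conjI ballI)
  qed
  have uniq: "\<beta> V x = \<beta>' V x"
    if G: "cat_module R C G" and \<beta>: "nat_trans R C L G \<beta>" "nat_trans R C L G \<beta>'"
      and a: "\<forall>V \<in> Obj B. \<forall>x \<in> carrier (Val F V). \<beta> V (\<eta> V x) = \<gamma> V x"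
        "\<forall>V \<in> Obj B. \<forall>x \<in> carrier (Val F V). \<beta>' V (\<eta> V x) = \<gamma> V x"
      and V: "V \<in> Obj C" "x \<in> carrier (Val L V)"
    for G :: "('o, 'm, 'k, 'c) module_functor" and \<beta> \<beta>' \<gamma> V x
  proof -
    let ?E = "\<lambda>V. {x \<in> carrier (Val L V). \<beta> V x = \<beta>' V x}"
    have "carrier (Val L V) \<subseteq> ?E V"
    proof (rule left_kan_extension_generated[OF B kan equalizer_submodule[OF L G \<beta>] _ V(1)])
      fix V x assume "V \<in> S" "x \<in> carrier (Val F V)"
      moreover from this have "\<eta> V x \<in> carrier (Val L V)"
        using \<eta> mod_homD(1)[of "\<eta> V" R "Val F V" "Val L V" x] BO by (simp add: nat_trans_def)
      ultimately show "\<eta> V x \<in> ?E V" using a BO by simp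
    qed
    then show ?thesis using V(2) by blast
  qed
  show ?thesis
    unfolding left_kan_extension_def
  proof (intro conjI allI impI)
    fix G :: "('o, 'm, 'k, 'c) module_functor" and \<gamma>
    assume "cat_module R C G \<and> nat_trans R B F G \<gamma>"
    then have G: "cat_module R C G" "nat_trans R B F G \<gamma>" by auto
    show "\<exists>\<beta>. nat_trans R C L G \<beta> \<and>
      (\<forall>V \<in> Obj B. \<forall>x \<in> carrier (Val F V). \<beta> V (\<eta> V x) = \<gamma> V x)"
      by (rule ex[OF G])
    show "\<forall>V \<in> Obj C. \<forall>x \<in> carrier (Val L V). \<beta> V x = \<beta>' V x"
      if "nat_trans R C L G \<beta> \<and> nat_trans R C L G \<beta>' \<and>
           (\<forall>V \<in> Obj B. \<forall>x \<in> carrier (Val F V). \<beta> V (\<eta> V x) = \<gamma> V x) \<and>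
           (\<forall>V \<in> Obj B. \<forall>x \<in> carrier (Val F V). \<beta>' V (\<eta> V x) = \<gamma> V x)" for \<beta> \<beta>'
      using that by (intro ballI uniq[OF G(1), of \<beta> \<beta>' \<gamma>]) auto
  qed (fact F L \<eta>)+
qed

end

theory Submission
  imports Defs
begin

text \<open>Two facts about a complemented category \<open>A\<close> carry the proof.  There is an arrow from \<open>V\<close> to \<open>W\<close>
  exactly if the rank of \<open>V\<close> is at most the rank of \<open>W\<close> (\<open>Hom_nonempty_iff_rank_le\<close>), and \<open>Aut W\<close> acts
  transitively on the arrows from \<open>V\<close> to \<open>W\<close> (\<open>Aut_transitive\<close>): two such arrows have complements of
  the same rank, and an isomorphism of the complements extends to an automorphism of \<open>W\<close>.  Hence an
  arrow out of \<open>V\<close> factors through any other arrow out of \<open>V\<close> whose target has no larger rank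
  (\<open>factor_through\<close>).

  Injectivity.  By \<open>factor_through\<close>, an element of \<open>M\<close> that one arrow kills is killed by all arrows
  to objects of sufficiently large rank.  Such elements form a submodule, which is finitely generated
  because \<open>A\<close> is locally Noetherian, so that one bound \<open>N\<close> serves for all of them.  If the rank of
  \<open>V\<close> is at least \<open>N\<close>, then the identity of \<open>V\<close> is among the arrows that kill them, so that no
  nonzero element at \<open>V\<close> is killed by an arrow.

  Surjectivity.  \<open>M\<close> at \<open>W\<close> is spanned by the images of finitely many generators under arrows into \<open>W\<close>.
  When the rank of \<open>V\<close> is at least the ranks of their objects, each of these arrows is, up to an
  automorphism of \<open>W\<close>, a composition of the given arrow from \<open>V\<close> to \<open>W\<close> with an arrow into \<open>V\<close>.

  Central stability.  This part works over any locally Noetherian category.  The free module on finitely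
  many generators of \<open>M\<close> is finitely generated, and so is the kernel of its map onto \<open>M\<close>.  A natural
  map out of \<open>M\<close> is therefore prescribed by the values on the generators, subject to finitely many
  relations.  If a full subcategory contains the objects of all generators and relations, then a natural
  map given on it only extends uniquely (\<open>left_kan_extension_of_presentation\<close>).\<close>

section \<open>Free modules over a category\<close>

definition free_module :: "('k, 'r) ring_scheme \<Rightarrow> 'j set \<Rightarrow> ('k, 'j \<Rightarrow> 'k) module" where
  "free_module R I =
     \<lparr>carrier = {c. range c \<subseteq> carrier R \<and> finite {j. c j \<noteq> \<zero>\<^bsub>R\<^esub>} \<and> {j. c j \<noteq> \<zero>\<^bsub>R\<^esub>} \<subseteq> I},
      monoid.mult = (\<lambda>_ _. undefined), one = undefined, zero = (\<lambda>_. \<zero>\<^bsub>R\<^esub>),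
      add = (\<lambda>c d j. c j \<oplus>\<^bsub>R\<^esub> d j), smult = (\<lambda>a c j. a \<otimes>\<^bsub>R\<^esub> c j)\<rparr>"

definition unit_vec :: "('k, 'r) ring_scheme \<Rightarrow> 'j \<Rightarrow> 'j \<Rightarrow> 'k" where
  "unit_vec R j = (\<lambda>i. if i = j then \<one>\<^bsub>R\<^esub> else \<zero>\<^bsub>R\<^esub>)"

definition lin_comb :: "('k, 'r) ring_scheme \<Rightarrow> ('k, 'b) module \<Rightarrow> ('j \<Rightarrow> 'b) \<Rightarrow> ('j \<Rightarrow> 'k) \<Rightarrow> 'b" where
  "lin_comb R P m c = finsum P (\<lambda>j. c j \<odot>\<^bsub>P\<^esub> m j) {j. c j \<noteq> \<zero>\<^bsub>R\<^esub>}"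

text \<open>The direct sum of the principal projective modules generated at the objects \<open>U i\<close> for \<open>i \<in> J\<close>: its
  value at \<open>V\<close> is free on the pairs of an index \<open>i\<close> and an arrow from \<open>U i\<close> to \<open>V\<close>, and arrows act on
  this basis by composition.\<close>

definition free_functor ::
  "'k ring \<Rightarrow> ('o, 'm, 'z) category_scheme \<Rightarrow> 'i set \<Rightarrow> ('i \<Rightarrow> 'o) \<Rightarrow>
   ('o, 'm, 'k, 'i \<times> 'm \<Rightarrow> 'k) module_functor" where
  "free_functor R C J U =
     \<lparr>Val = (\<lambda>V. free_module R (SIGMA i:J. Hom C (U i) V)),
      Map = (\<lambda>g. lin_comb R (free_module R (SIGMA i:J. Hom C (U i) (Cod C g)))
        (\<lambda>(i, f). unit_vec R (i, g \<cdot>\<^bsub>C\<^esub> f)))\<rparr>"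

text \<open>The map out of the free module that the Yoneda lemma assigns to the elements \<open>x i\<close> at \<open>U i\<close>.\<close>

definition free_eval ::
  "'k ring \<Rightarrow> ('o, 'm, 'k, 'b) module_functor \<Rightarrow> ('i \<Rightarrow> 'b) \<Rightarrow> 'o \<Rightarrow> ('i \<times> 'm \<Rightarrow> 'k) \<Rightarrow> 'b" where
  "free_eval R M x V = lin_comb R (Val M V) (\<lambda>(i, f). Map M f (x i))"

context cring begin

lemma free_module_module: "module R (free_module R I)"
proof -
  have cl: "c j \<in> carrier R" if "c \<in> carrier (free_module R I)" for c j
    using that by (auto simp: free_module_def)
  \<comment> \<open>One closure argument for addition, negation and scalar multiplication; the unary operations
    ignore the second vector.\<close>
  have memI: "(\<lambda>j. h (c j) (d j)) \<in> carrier (free_module R I)"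
    if "c \<in> carrier (free_module R I)" "d \<in> carrier (free_module R I)"
      "\<And>a b. a \<in> carrier R \<Longrightarrow> b \<in> carrier R \<Longrightarrow> h a b \<in> carrier R" "h \<zero> \<zero> = \<zero>" for h c d
  proof -
    have s: "{j. h (c j) (d j) \<noteq> \<zero>} \<subseteq> {j. c j \<noteq> \<zero>} \<union> {j. d j \<noteq> \<zero>}" using that(4) by auto
    have "finite ({j. c j \<noteq> \<zero>} \<union> {j. d j \<noteq> \<zero>})" "{j. c j \<noteq> \<zero>} \<union> {j. d j \<noteq> \<zero>} \<subseteq> I"
      using that(1,2) by (auto simp: free_module_def)
    moreover have "range (\<lambda>j. h (c j) (d j)) \<subseteq> carrier R" using that(3) cl[OF that(1)] cl[OF that(2)] by blast
    ultimately show ?thesis unfolding free_module_def using finite_subset[OF s] subset_trans[OF s] by simp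
  qed
  have ops: "c \<oplus>\<^bsub>free_module R I\<^esub> d = (\<lambda>j. c j \<oplus> d j)" "\<zero>\<^bsub>free_module R I\<^esub> = (\<lambda>_. \<zero>)"
    "a \<odot>\<^bsub>free_module R I\<^esub> c = (\<lambda>j. a \<otimes> c j)" for a c d
    by (simp_all add: free_module_def)
  show ?thesis
  proof (rule moduleI)
    show "abelian_group (free_module R I)"
    proof (rule abelian_groupI, goal_cases)
      case (1 c d) then show ?case unfolding ops by (intro memI[of c d "(\<oplus>)"]) auto
    next
      case 2 show ?case by (auto simp: free_module_def)
    next
      case (6 c)
      then have "(\<lambda>j. \<ominus> c j) \<in> carrier (free_module R I)" by (intro memI[of c c "\<lambda>a _. \<ominus> a"]) auto
      then show ?case using cl[OF 6] unfolding ops by (intro bexI[of _ "\<lambda>j. \<ominus> c j"]) (simp_all add: l_neg)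
    next
      case (3 c d e) then show ?case unfolding ops using cl[OF 3(1)] cl[OF 3(2)] cl[OF 3(3)] by (simp add: a_assoc)
    next
      case (4 c d) then show ?case unfolding ops using cl[OF 4(1)] cl[OF 4(2)] by (simp add: a_comm)
    next
      case (5 c) then show ?case unfolding ops using cl[OF 5] by simp
    qed
  next
    fix a c assume "a \<in> carrier R" "c \<in> carrier (free_module R I)"
    then show "a \<odot>\<^bsub>free_module R I\<^esub> c \<in> carrier (free_module R I)"
      unfolding ops by (intro memI[of c c "\<lambda>b _. a \<otimes> b"]) auto
  next
    fix a b c assume a: "a \<in> carrier R" "b \<in> carrier R" and c: "c \<in> carrier (free_module R I)"
    then show "(a \<oplus> b) \<odot>\<^bsub>free_module R I\<^esub> c =
        a \<odot>\<^bsub>free_module R I\<^esub> c \<oplus>\<^bsub>free_module R I\<^esub> b \<odot>\<^bsub>free_module R I\<^esub> c"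
      "(a \<otimes> b) \<odot>\<^bsub>free_module R I\<^esub> c = a \<odot>\<^bsub>free_module R I\<^esub> (b \<odot>\<^bsub>free_module R I\<^esub> c)"
      unfolding ops using cl[OF c] by (simp_all add: l_distr m_assoc)
  next
    fix a c d
    assume a: "a \<in> carrier R" and c: "c \<in> carrier (free_module R I)" and d: "d \<in> carrier (free_module R I)"
    then show "a \<odot>\<^bsub>free_module R I\<^esub> (c \<oplus>\<^bsub>free_module R I\<^esub> d) =
        a \<odot>\<^bsub>free_module R I\<^esub> c \<oplus>\<^bsub>free_module R I\<^esub> a \<odot>\<^bsub>free_module R I\<^esub> d"
      unfolding ops using cl[OF c] cl[OF d] by (simp add: r_distr)
  next
    fix c assume c: "c \<in> carrier (free_module R I)"
    show "\<one> \<odot>\<^bsub>free_module R I\<^esub> c = c" unfolding ops using cl[OF c] by simp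
  qed (rule is_cring)
qed

lemma unit_vec_closed: "j \<in> I \<Longrightarrow> unit_vec R j \<in> carrier (free_module R I)"
  by (auto simp: free_module_def unit_vec_def image_subset_iff)

text \<open>Every finitely supported function is a finite combination of unit vectors, by induction on a finite set
  that contains the support.\<close>

lemma free_module_induct:
  fixes I :: "'j set"
  assumes H: "submodule H R (free_module R I)" and unit: "\<And>j. j \<in> I \<Longrightarrow> unit_vec R j \<in> H"
  shows "carrier (free_module R I) \<subseteq> H"
proof
  note cl = submodule_closed[OF free_module_module H]
  fix c assume "c \<in> carrier (free_module R I)"
  then have c: "range c \<subseteq> carrier R" "finite {j. c j \<noteq> \<zero>}" "{j. c j \<noteq> \<zero>} \<subseteq> I"
    by (auto simp: free_module_def)
  have "\<forall>c. range c \<subseteq> carrier R \<and> {j. c j \<noteq> \<zero>} \<subseteq> F \<longrightarrow> c \<in> H" if "finite F" "F \<subseteq> I" for F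
    using that
  proof (induction F)
    case empty
    show ?case
    proof (intro allI impI)
      fix c :: "'j \<Rightarrow> 'a" assume "range c \<subseteq> carrier R \<and> {j. c j \<noteq> \<zero>} \<subseteq> {}"
      then have "c = \<zero>\<^bsub>free_module R I\<^esub>" by (auto simp: free_module_def)
      then show "c \<in> H" using submodule_zero[OF H] by simp
    qed
  next
    case (insert j F)
    show ?case
    proof (intro allI impI)
      fix c assume c: "range c \<subseteq> carrier R \<and> {j. c j \<noteq> \<zero>} \<subseteq> insert j F"
      then have cR: "c i \<in> carrier R" for i by auto
      have "range (c(j := \<zero>)) \<subseteq> carrier R \<and> {i. (c(j := \<zero>)) i \<noteq> \<zero>} \<subseteq> F" using c by auto
      then have "c(j := \<zero>) \<in> H" using insert by blast
      moreover have "c j \<odot>\<^bsub>free_module R I\<^esub> unit_vec R j \<in> H"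
        using insert.prems cR by (intro cl(3) unit) auto
      moreover have "c = c(j := \<zero>) \<oplus>\<^bsub>free_module R I\<^esub> c j \<odot>\<^bsub>free_module R I\<^esub> unit_vec R j"
        using cR by (auto simp: free_module_def unit_vec_def fun_eq_iff)
      ultimately show "c \<in> H" using cl(2) by metis
    qed
  qed
  then show "c \<in> H" using c by blast
qed

text \<open>The set on which two homomorphisms agree is a submodule, so agreement need only be tested on the unit
  vectors.  All identities between maps out of free modules below are reduced to the basis in this way,
  which avoids manipulating sums.\<close>

lemma free_module_hom_eqI:
  assumes Q: "module R Q"
    and h: "h \<in> mod_hom R (free_module R I) Q" "h' \<in> mod_hom R (free_module R I) Q"
    and eq: "\<And>j. j \<in> I \<Longrightarrow> h (unit_vec R j) = h' (unit_vec R j)"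
    and c: "c \<in> carrier (free_module R I)"
  shows "h c = h' c"
proof -
  interpret F: module R "free_module R I" by (rule free_module_module)
  note z = mod_hom_zero[OF free_module_module Q]
  have "submodule {c \<in> carrier (free_module R I). h c = h' c} R (free_module R I)"
    by (rule F.submoduleI') (auto simp: mod_homD[OF h(1)] mod_homD[OF h(2)] z[OF h(1)] z[OF h(2)])
  then have "carrier (free_module R I) \<subseteq> {c \<in> carrier (free_module R I). h c = h' c}"
    by (rule free_module_induct) (simp add: eq unit_vec_closed)
  then show ?thesis using c by (simp add: subset_iff)
qed

text \<open>Additivity is checked after both sums are extended to the union of the two supports, as the support of a
  sum of vectors can be smaller than that union.\<close>

lemma lin_comb_hom:
  assumes P: "module R P" and m: "\<And>j. j \<in> I \<Longrightarrow> m j \<in> carrier P"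
  shows "lin_comb R P m \<in> mod_hom R (free_module R I) P"
proof -
  interpret P: module R P by fact
  have sub: "lin_comb R P m c = finsum P (\<lambda>j. c j \<odot>\<^bsub>P\<^esub> m j) F"
    if "range c \<subseteq> carrier R" "finite F" "{j. c j \<noteq> \<zero>} \<subseteq> F" "F \<subseteq> I" for c F
    unfolding lin_comb_def
    by (rule P.M.add.finprod_mono_neutral_cong_left[OF that(2,3)])
      (use that m in \<open>auto simp: image_subset_iff subset_iff\<close>)
  show ?thesis unfolding mod_hom_def
  proof (intro CollectI conjI ballI funcsetI)
    fix c assume "c \<in> carrier (free_module R I)"
    then have c: "range c \<subseteq> carrier R" "finite {j. c j \<noteq> \<zero>}" "{j. c j \<noteq> \<zero>} \<subseteq> I"
      by (auto simp: free_module_def)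
    show "lin_comb R P m c \<in> carrier P"
      unfolding lin_comb_def using c m by (intro P.M.finsum_closed) (auto simp: image_subset_iff)
    show "lin_comb R P m (a \<odot>\<^bsub>free_module R I\<^esub> c) = a \<odot>\<^bsub>P\<^esub> lin_comb R P m c"
      if a: "a \<in> carrier R" for a
    proof -
      have "lin_comb R P m (\<lambda>j. a \<otimes> c j) = finsum P (\<lambda>j. (a \<otimes> c j) \<odot>\<^bsub>P\<^esub> m j) {j. c j \<noteq> \<zero>}"
        using a c by (intro sub) (auto simp: image_subset_iff)
      also have "\<dots> = finsum P (\<lambda>j. a \<odot>\<^bsub>P\<^esub> (c j \<odot>\<^bsub>P\<^esub> m j)) {j. c j \<noteq> \<zero>}"
        using a c m by (intro P.M.finsum_cong') (auto simp: image_subset_iff subset_iff P.smult_assoc1)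
      also have "\<dots> = a \<odot>\<^bsub>P\<^esub> lin_comb R P m c"
        unfolding lin_comb_def using a c m
        by (intro P.finsum_smult_ldistr[symmetric]) (auto simp: image_subset_iff subset_iff)
      finally show ?thesis by (simp add: free_module_def)
    qed
    fix d assume "d \<in> carrier (free_module R I)"
    then have d: "range d \<subseteq> carrier R" "finite {j. d j \<noteq> \<zero>}" "{j. d j \<noteq> \<zero>} \<subseteq> I"
      by (auto simp: free_module_def)
    let ?F = "{j. c j \<noteq> \<zero>} \<union> {j. d j \<noteq> \<zero>}"
    have "lin_comb R P m (\<lambda>j. c j \<oplus> d j) = finsum P (\<lambda>j. (c j \<oplus> d j) \<odot>\<^bsub>P\<^esub> m j) ?F"
      using c d by (intro sub) (auto simp: image_subset_iff)
    also have "\<dots> = finsum P (\<lambda>j. c j \<odot>\<^bsub>P\<^esub> m j \<oplus>\<^bsub>P\<^esub> d j \<odot>\<^bsub>P\<^esub> m j) ?F"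
      using c d m by (intro P.M.finsum_cong') (auto simp: image_subset_iff subset_iff P.smult_l_distr)
    also have "\<dots> = finsum P (\<lambda>j. c j \<odot>\<^bsub>P\<^esub> m j) ?F \<oplus>\<^bsub>P\<^esub> finsum P (\<lambda>j. d j \<odot>\<^bsub>P\<^esub> m j) ?F"
      using c d m by (intro P.M.finsum_addf) (auto simp: image_subset_iff subset_iff)
    also have "\<dots> = lin_comb R P m c \<oplus>\<^bsub>P\<^esub> lin_comb R P m d"
      using c d sub[of c ?F] sub[of d ?F] by simp
    finally show "lin_comb R P m (c \<oplus>\<^bsub>free_module R I\<^esub> d) = lin_comb R P m c \<oplus>\<^bsub>P\<^esub> lin_comb R P m d"
      by (simp add: free_module_def)
  qed
qed

lemma lin_comb_unit_vec:
  assumes P: "module R P" and m: "m j \<in> carrier P"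
  shows "lin_comb R P m (unit_vec R j) = m j"
proof -
  interpret P: module R P by fact
  show ?thesis
  proof (cases "\<one> = \<zero>")
    \<comment> \<open>Over the zero ring the unit vector has empty support, but then every module is zero.\<close>
    case True
    then have "m j = \<zero>\<^bsub>P\<^esub>" using P.smult_one[OF m] P.smult_l_null[OF m] by simp
    then show ?thesis using True by (simp add: lin_comb_def unit_vec_def)
  next
    case False
    then have "{i. unit_vec R j i \<noteq> \<zero>} = {j}" by (auto simp: unit_vec_def)
    then show ?thesis using m by (simp add: lin_comb_def unit_vec_def)
  qed
qed

end

lemma mod_hom_comp:
  assumes "h \<in> mod_hom R P Q" "k \<in> mod_hom R Q T"
  shows "(\<lambda>x. k (h x)) \<in> mod_hom R P T"
  using assms unfolding mod_hom_def by (auto simp: Pi_iff)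

lemma mod_hom_id: "(\<lambda>x. x) \<in> mod_hom R P P"
  by (simp add: mod_hom_def)

lemma free_functor_module:
  assumes R: "cring R" and C: "category C"
  shows "cat_module R C (free_functor R C J U)"
    and "i \<in> J \<Longrightarrow> f \<in> Hom C (U i) V \<Longrightarrow> g \<in> Hom C V W \<Longrightarrow>
      Map (free_functor R C J U) g (unit_vec R (i, f)) = unit_vec R (i, g \<cdot>\<^bsub>C\<^esub> f)"
proof -
  interpret cring R by fact
  interpret category C by fact
  let ?F = "free_functor R C J U" and ?I = "\<lambda>V. SIGMA i:J. Hom C (U i) V"
  have Val: "Val ?F V = free_module R (?I V)" for V by (simp add: free_functor_def)
  have hom: "Map ?F g \<in> mod_hom R (Val ?F V) (Val ?F W)" if g: "g \<in> Hom C V W" for g V W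
  proof -
    have "lin_comb R (free_module R (?I W)) (\<lambda>(i, f). unit_vec R (i, g \<cdot>\<^bsub>C\<^esub> f))
      \<in> mod_hom R (free_module R (?I V)) (free_module R (?I W))"
      using comp_Hom[OF _ g] by (intro lin_comb_hom[OF free_module_module]) (auto intro!: unit_vec_closed)
    then show ?thesis using g by (simp add: free_functor_def Hom_def)
  qed
  have unit: "Map ?F g (unit_vec R (i, f)) = unit_vec R (i, g \<cdot>\<^bsub>C\<^esub> f)"
    if "i \<in> J" "f \<in> Hom C (U i) V" "g \<in> Hom C V W" for i f g V W
  proof -
    have "unit_vec R (i, g \<cdot>\<^bsub>C\<^esub> f) \<in> carrier (free_module R (?I W))"
      using that comp_Hom[OF that(2,3)] by (intro unit_vec_closed) auto
    then show ?thesis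
      using that lin_comb_unit_vec[OF free_module_module,
          of "\<lambda>(i, f). unit_vec R (i, g \<cdot>\<^bsub>C\<^esub> f)" "(i, f)" "?I W"]
      by (simp add: free_functor_def Hom_def)
  qed
  then show "i \<in> J \<Longrightarrow> f \<in> Hom C (U i) V \<Longrightarrow> g \<in> Hom C V W \<Longrightarrow>
      Map (free_functor R C J U) g (unit_vec R (i, f)) = unit_vec R (i, g \<cdot>\<^bsub>C\<^esub> f)" .
  show "cat_module R C ?F"
  proof (intro cat_module.intro cat_module_axioms.intro is_cring category_axioms, goal_cases)
    case (1 V) show ?case by (simp add: Val free_module_module)
  next
    case (2 f V W) then show ?case by (rule hom)
  next
    case (3 V c)
    show ?case
      by (rule free_module_hom_eqI[OF free_module_module hom[OF Ide_Hom[OF 3(1)], unfolded Val] mod_hom_id])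
        (use 3 in \<open>auto simp: Val unit[OF _ _ Ide_Hom] Ide_comp\<close>)
  next
    case (4 f Z V g W c)
    note gf = comp_Hom[OF 4(1,2)]
    show ?case
    proof (rule free_module_hom_eqI[OF free_module_module hom[OF gf, unfolded Val]
          mod_hom_comp[OF hom[OF 4(1)] hom[OF 4(2)], unfolded Val]])
      show "Map ?F (g \<cdot>\<^bsub>C\<^esub> f) (unit_vec R j) = Map ?F g (Map ?F f (unit_vec R j))" if "j \<in> ?I Z" for j
        using that 4 comp_Hom[OF _ 4(1)]
        by (auto simp: unit[OF _ _ gf] unit[OF _ _ 4(1)] unit[OF _ _ 4(2)] comp_assoc)
    qed (use 4 in \<open>simp add: Val\<close>)
  qed
qed

text \<open>The basis vector of \<open>(i, f)\<close> is the image under \<open>f\<close> of the basis vector of \<open>(i, Ide C (U i))\<close>, so the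
  latter generate.\<close>

lemma fin_generated_free_functor:
  assumes R: "cring R" and C: "category C" and J: "finite J" "\<And>i. i \<in> J \<Longrightarrow> U i \<in> Obj C"
  shows "fin_generated R C (free_functor R C J U)"
proof -
  interpret cring R by fact
  interpret category C by fact
  let ?F = "free_functor R C J U"
  let ?G = "(\<lambda>i. (U i, unit_vec R (i, Ide C (U i)))) ` J"
  note F = free_functor_module[OF R C, where J = J and U = U]
  have Val: "Val ?F V = free_module R (SIGMA i:J. Hom C (U i) V)" for V
    by (simp add: free_functor_def)
  have "carrier (Val ?F V) \<subseteq> S V"
    if S: "cat_submodule R C ?F S" and G: "\<forall>(W, c) \<in> ?G. c \<in> S W" and V: "V \<in> Obj C" for S V
  proof -
    have u: "unit_vec R j \<in> S V" if j: "j \<in> (SIGMA i:J. Hom C (U i) V)" for j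
    proof -
      obtain i f where j: "j = (i, f)" "i \<in> J" "f \<in> Hom C (U i) V" using j by auto
      have "Map ?F f (unit_vec R (i, Ide C (U i))) \<in> S (Cod C f)"
        using j G by (intro cat_submoduleD(2)[OF S]) (auto simp: Hom_def)
      then show ?thesis
        using j F(2)[OF j(2) Ide_Hom[OF J(2)] j(3)] by (simp add: comp_Ide Hom_def)
    qed
    have "submodule (S V) R (free_module R (SIGMA i:J. Hom C (U i) V))"
      using cat_submoduleD(1)[OF S V] by (simp add: Val)
    from free_module_induct[OF this u] show ?thesis unfolding Val .
  qed
  moreover have "\<forall>(W, c) \<in> ?G. W \<in> Obj C \<and> c \<in> carrier (Val ?F W)"
    using J(2) Ide_Hom by (auto simp: free_functor_def intro!: unit_vec_closed)
  ultimately show ?thesis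
    unfolding fin_generated_iff[OF F(1)] using J(1) by (intro exI[of _ ?G] conjI allI impI ballI) auto
qed

context cat_module begin

lemma free_eval_hom:
  assumes "V \<in> Obj C" "\<And>i. i \<in> J \<Longrightarrow> x i \<in> carrier (Val M (U i))"
  shows "free_eval R M x V \<in> mod_hom R (Val (free_functor R C J U) V) (Val M V)"
  unfolding free_eval_def free_functor_def
  using assms(2) mod_homD(1)[OF Map_hom]
  by (auto intro!: lin_comb_hom[OF Val_module[OF assms(1)]])

lemma free_eval_unit_vec:
  assumes "x i \<in> carrier (Val M (U i))" "f \<in> Hom C (U i) V"
  shows "free_eval R M x V (unit_vec R (i, f)) = Map M f (x i)"
proof -
  have "V \<in> Obj C" using assms(2) Cod_Obj by (auto simp: Hom_def)
  then show ?thesis unfolding free_eval_def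
    using lin_comb_unit_vec[OF Val_module, of V "\<lambda>(i, f). Map M f (x i)" "(i, f)"]
      mod_homD(1)[OF Map_hom[OF assms(2)] assms(1)] by simp
qed

lemma free_eval_nat_trans:
  assumes x: "\<And>i. i \<in> J \<Longrightarrow> x i \<in> carrier (Val M (U i))"
  shows "nat_trans R C (free_functor R C J U) M (free_eval R M x)"
proof -
  let ?F = "free_functor R C J U"
  note F = free_functor_module[OF is_cring category_axioms, where J = J and U = U]
  interpret F: cat_module R C ?F by (rule F(1))
  note h = free_eval_hom[where J = J and U = U and x = x, OF _ x]
  have "free_eval R M x (Cod C g) (Map ?F g c) = Map M g (free_eval R M x (Dom C g) c)"
    if g: "g \<in> Arr C" and c: "c \<in> carrier (Val ?F (Dom C g))" for g c
  proof -
    note O = Dom_Obj[OF g] Cod_Obj[OF g]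
    have gH: "g \<in> Hom C (Dom C g) (Cod C g)" using g by (simp add: Hom_def)
    have Val: "Val ?F V = free_module R (SIGMA i:J. Hom C (U i) V)" for V
      by (simp add: free_functor_def)
    show ?thesis
    proof (rule free_module_hom_eqI[OF Val_module[OF O(2)]
          mod_hom_comp[OF F.Map_hom'[OF g] h[OF O(2)], unfolded Val[of "Dom C g"]]
          mod_hom_comp[OF h[OF O(1)] Map_hom'[OF g], unfolded Val[of "Dom C g"]]])
      fix j assume "j \<in> (SIGMA i:J. Hom C (U i) (Dom C g))"
      then obtain i f where j: "j = (i, f)" "i \<in> J" "f \<in> Hom C (U i) (Dom C g)" by auto
      show "free_eval R M x (Cod C g) (Map ?F g (unit_vec R j)) =
        Map M g (free_eval R M x (Dom C g) (unit_vec R j))"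
        using x[OF j(2)] j
        by (simp add: F(2)[OF j(2,3) gH] free_eval_unit_vec[where U = U and x = x, OF x] comp_Hom[OF j(3) gH] Map_comp[OF j(3) gH])
    qed (use c Val in auto)
  qed
  then show ?thesis unfolding nat_trans_def using h by simp
qed

lemma free_eval_surj:
  assumes U: "\<And>i. i \<in> J \<Longrightarrow> U i \<in> Obj C" and x: "\<And>i. i \<in> J \<Longrightarrow> x i \<in> carrier (Val M (U i))"
    and gen: "\<And>S V. cat_submodule R C M S \<Longrightarrow> (\<And>i. i \<in> J \<Longrightarrow> x i \<in> S (U i)) \<Longrightarrow> V \<in> Obj C \<Longrightarrow>
      carrier (Val M V) \<subseteq> S V"
    and V: "V \<in> Obj C"
  shows "carrier (Val M V) \<subseteq> free_eval R M x V ` carrier (Val (free_functor R C J U) V)"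
proof (rule gen[OF _ _ V])
  let ?F = "free_functor R C J U"
  note F = free_functor_module(1)[OF is_cring category_axioms, where J = J and U = U]
  interpret F: cat_module R C ?F by (rule F)
  show "cat_submodule R C M (\<lambda>V. free_eval R M x V ` carrier (Val ?F V))"
    by (rule cat_submodule_image[OF F cat_module_axioms free_eval_nat_trans[OF x] F.carrier_cat_submodule])
  fix i assume i: "i \<in> J"
  have "x i = free_eval R M x (U i) (unit_vec R (i, Ide C (U i)))"
    using free_eval_unit_vec[where U = U and x = x, OF x[OF i] Ide_Hom[OF U[OF i]]] Map_Ide[OF U[OF i] x[OF i]] by simp
  moreover have "unit_vec R (i, Ide C (U i)) \<in> carrier (Val ?F (U i))"
    using i Ide_Hom[OF U[OF i]] by (auto simp: free_functor_def intro!: unit_vec_closed)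
  ultimately show "x i \<in> free_eval R M x (U i) ` carrier (Val ?F (U i))" by blast
qed

end

section \<open>Presentations and left Kan extensions\<close>

text \<open>Reduces injectivity and well-definedness questions to kernels.\<close>

lemma mod_hom_eq_iff:
  assumes P: "module R P" and Q: "module R Q" and h: "h \<in> mod_hom R P Q"
    and x: "x \<in> carrier P" and y: "y \<in> carrier P"
  shows "h x = h y \<longleftrightarrow> h (x \<ominus>\<^bsub>P\<^esub> y) = \<zero>\<^bsub>Q\<^esub>"
proof -
  interpret P: module R P by fact
  interpret Q: module R Q by fact
  note hD = mod_homD[OF h]
  have "h (x \<oplus>\<^bsub>P\<^esub> (\<ominus>\<^bsub>R\<^esub> \<one>\<^bsub>R\<^esub>) \<odot>\<^bsub>P\<^esub> y) = h x \<oplus>\<^bsub>Q\<^esub> (\<ominus>\<^bsub>R\<^esub> \<one>\<^bsub>R\<^esub>) \<odot>\<^bsub>Q\<^esub> h y"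
    using x y by (simp add: hD(2,3))
  then have "h (x \<ominus>\<^bsub>P\<^esub> y) = h x \<ominus>\<^bsub>Q\<^esub> h y"
    using x y hD(1) by (simp add: a_minus_def P.smult_l_minus Q.smult_l_minus)
  moreover have "a \<ominus>\<^bsub>Q\<^esub> b = \<zero>\<^bsub>Q\<^esub> \<longleftrightarrow> a = b" if "a \<in> carrier Q" "b \<in> carrier Q" for a b
    using that by (metis Q.M.a_inv_closed Q.M.minus_equality Q.M.minus_minus Q.M.r_neg a_minus_def)
  ultimately show ?thesis using x y hD(1) by simp
qed

text \<open>The homomorphism theorem for modules over a category: \<open>\<psi>\<close> descends along the surjection \<open>\<phi>\<close> because it
  vanishes on the kernel of \<open>\<phi>\<close>.\<close>

lemma nat_trans_factor:
  assumes P: "cat_module R C P" and M: "cat_module R C M" and G: "cat_module R C G"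
    and \<phi>: "nat_trans R C P M \<phi>" and \<psi>: "nat_trans R C P G \<psi>"
    and surj: "\<And>V. V \<in> Obj C \<Longrightarrow> carrier (Val M V) \<subseteq> \<phi> V ` carrier (Val P V)"
    and ker: "\<And>V c. V \<in> Obj C \<Longrightarrow> c \<in> carrier (Val P V) \<Longrightarrow> \<phi> V c = \<zero>\<^bsub>Val M V\<^esub> \<Longrightarrow> \<psi> V c = \<zero>\<^bsub>Val G V\<^esub>"
  shows "\<exists>\<beta>. nat_trans R C M G \<beta> \<and> (\<forall>V \<in> Obj C. \<forall>c \<in> carrier (Val P V). \<beta> V (\<phi> V c) = \<psi> V c)"
proof -
  interpret P: cat_module R C P by fact
  interpret M: cat_module R C M by fact
  interpret G: cat_module R C G by fact
  define \<beta> where "\<beta> V y = \<psi> V (SOME c. c \<in> carrier (Val P V) \<and> \<phi> V c = y)" for V y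
  have h: "\<phi> V \<in> mod_hom R (Val P V) (Val M V)" "\<psi> V \<in> mod_hom R (Val P V) (Val G V)"
    if "V \<in> Obj C" for V using \<phi> \<psi> that by (auto simp: nat_trans_def)
  have wd: "\<psi> V c = \<psi> V d"
    if V: "V \<in> Obj C" and c: "c \<in> carrier (Val P V)" and d: "d \<in> carrier (Val P V)"
      and eq: "\<phi> V c = \<phi> V d" for V c d
  proof -
    interpret PV: module R "Val P V" by (rule P.Val_module[OF V])
    have "\<phi> V (c \<ominus>\<^bsub>Val P V\<^esub> d) = \<zero>\<^bsub>Val M V\<^esub>"
      using mod_hom_eq_iff[OF P.Val_module[OF V] M.Val_module[OF V] h(1)[OF V] c d] eq by simp
    then have "\<psi> V (c \<ominus>\<^bsub>Val P V\<^esub> d) = \<zero>\<^bsub>Val G V\<^esub>" using c d by (intro ker[OF V]) auto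
    then show ?thesis
      using mod_hom_eq_iff[OF P.Val_module[OF V] G.Val_module[OF V] h(2)[OF V] c d] by simp
  qed
  have \<beta>: "\<beta> V (\<phi> V c) = \<psi> V c" if "V \<in> Obj C" "c \<in> carrier (Val P V)" for V c
  proof -
    have "\<exists>d. d \<in> carrier (Val P V) \<and> \<phi> V d = \<phi> V c" using that by auto
    from someI_ex[OF this] show ?thesis unfolding \<beta>_def using that by (intro wd) auto
  qed
  have lift: "\<exists>c \<in> carrier (Val P V). y = \<phi> V c" if "V \<in> Obj C" "y \<in> carrier (Val M V)" for V y
    using surj that by blast
  have "nat_trans R C M G \<beta>" unfolding nat_trans_def
  proof (intro conjI ballI)
    fix V assume V: "V \<in> Obj C"
    interpret PV: module R "Val P V" by (rule P.Val_module[OF V])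
    note f = mod_homD[OF h(1)[OF V]] and g = mod_homD[OF h(2)[OF V]]
    show "\<beta> V \<in> mod_hom R (Val M V) (Val G V)" unfolding mod_hom_def
    proof (intro CollectI conjI ballI funcsetI)
      fix y assume "y \<in> carrier (Val M V)"
      then obtain c where c: "c \<in> carrier (Val P V)" "y = \<phi> V c" using lift V by blast
      show "\<beta> V y \<in> carrier (Val G V)" using c V \<beta> g(1) by simp
      show "\<beta> V (a \<odot>\<^bsub>Val M V\<^esub> y) = a \<odot>\<^bsub>Val G V\<^esub> \<beta> V y" if a: "a \<in> carrier R" for a
        using c V \<beta>[OF V, of "a \<odot>\<^bsub>Val P V\<^esub> c"] \<beta>[OF V c(1)] a by (simp add: f(3) g(3))
      fix z assume "z \<in> carrier (Val M V)"
      then obtain d where d: "d \<in> carrier (Val P V)" "z = \<phi> V d" using lift V by blast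
      show "\<beta> V (y \<oplus>\<^bsub>Val M V\<^esub> z) = \<beta> V y \<oplus>\<^bsub>Val G V\<^esub> \<beta> V z"
        using c d \<beta>[OF V, of "c \<oplus>\<^bsub>Val P V\<^esub> d"] \<beta>[OF V c(1)] \<beta>[OF V d(1)] by (simp add: f(2) g(2))
    qed
  next
    fix u y assume u: "u \<in> Arr C" and "y \<in> carrier (Val M (Dom C u))"
    then obtain c where c: "c \<in> carrier (Val P (Dom C u))" "y = \<phi> (Dom C u) c"
      using lift P.Dom_Obj by blast
    note O = P.Dom_Obj[OF u] P.Cod_Obj[OF u]
    have n: "\<phi> (Cod C u) (Map P u c) = Map M u (\<phi> (Dom C u) c)"
      "\<psi> (Cod C u) (Map P u c) = Map G u (\<psi> (Dom C u) c)"
      using \<phi> \<psi> u c by (auto simp: nat_trans_def)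
    show "\<beta> (Cod C u) (Map M u y) = Map G u (\<beta> (Dom C u) y)"
      using \<beta>[OF O(2) mod_homD(1)[OF P.Map_hom'[OF u] c(1)]] \<beta>[OF O(1) c(1)] n c(2) by simp
  qed
  with \<beta> show ?thesis by blast
qed

lemma (in cat_module) zero_cat_submodule: "cat_submodule R C M (\<lambda>V. {\<zero>\<^bsub>Val M V\<^esub>})"
proof -
  have "submodule {\<zero>\<^bsub>Val M V\<^esub>} R (Val M V)" if "V \<in> Obj C" for V
  proof -
    interpret V: module R "Val M V" by (rule Val_module[OF that])
    show ?thesis by (rule V.submoduleI') auto
  qed
  then show ?thesis unfolding cat_submodule_def
    using mod_hom_zero[OF Val_module Val_module Map_hom'] Dom_Obj Cod_Obj by auto
qed

lemma cat_module_full_subcategory: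
  assumes "cat_module R C M" "S \<subseteq> Obj C"
  shows "cat_module R (full_subcategory C S) M"
proof -
  interpret cat_module R C M by fact
  have H: "f \<in> Hom (full_subcategory C S) V W \<longleftrightarrow> f \<in> Hom C V W \<and> V \<in> S \<and> W \<in> S" for f V W
    by (auto simp: full_subcategory_def Hom_def)
  have s: "Obj (full_subcategory C S) = S" "Ide (full_subcategory C S) = Ide C"
    "comp_arr (full_subcategory C S) = comp_arr C"
    by (simp_all add: full_subcategory_def)
  have "category (full_subcategory C S)"
    unfolding category_def H s
    using assms(2) Ide_Hom comp_Hom comp_Ide Ide_comp comp_assoc
    by (auto simp: full_subcategory_def)
  then show ?thesis
    unfolding cat_module_def cat_module_axioms_def H s
    using assms(2) Val_module Map_hom Map_Ide Map_comp is_cring by auto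
qed

text \<open>The \<open>x i\<close> generate \<open>M\<close>, and \<open>rel\<close> says that the kernel of the map from the free module onto \<open>M\<close> is
  generated by its values on \<open>S\<close>.  Given \<open>\<gamma>\<close> from \<open>M\<close> to \<open>G\<close> on the full subcategory on \<open>S\<close>, the elements
  \<open>\<gamma> (U i) (x i)\<close> define a map from the free module to \<open>G\<close> on all of \<open>C\<close>.  On \<open>S\<close> it is \<open>\<gamma>\<close> after the
  map onto \<open>M\<close>, so it kills the relations over \<open>S\<close>, hence all relations, and it descends to \<open>M\<close>.
  Two extensions of \<open>\<gamma>\<close> agree on the generators, hence everywhere.\<close>

lemma left_kan_extension_of_presentation:
  fixes M :: "('o, 'm, 'k, 'b) module_functor" and C :: "('o, 'm, 'z) category_scheme"
  assumes M: "cat_module R C M" and S: "S \<subseteq> Obj C" and U: "\<And>i. i \<in> J \<Longrightarrow> U i \<in> S"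
    and x: "\<And>i. i \<in> J \<Longrightarrow> x i \<in> carrier (Val M (U i))"
    and gen: "\<And>T V. cat_submodule R C M T \<Longrightarrow> (\<And>i. i \<in> J \<Longrightarrow> x i \<in> T (U i)) \<Longrightarrow> V \<in> Obj C \<Longrightarrow>
      carrier (Val M V) \<subseteq> T V"
    and rel: "\<And>T V c. cat_submodule R C (free_functor R C J U) T \<Longrightarrow>
      (\<And>V c. V \<in> S \<Longrightarrow> c \<in> carrier (Val (free_functor R C J U) V) \<Longrightarrow>
        free_eval R M x V c = \<zero>\<^bsub>Val M V\<^esub> \<Longrightarrow> c \<in> T V) \<Longrightarrow>
      V \<in> Obj C \<Longrightarrow> c \<in> carrier (Val (free_functor R C J U) V) \<Longrightarrow>
        free_eval R M x V c = \<zero>\<^bsub>Val M V\<^esub> \<Longrightarrow> c \<in> T V"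
  shows "left_kan_extension TYPE('c) R (full_subcategory C S) C M M (\<lambda>V x. x)"
proof -
  interpret cat_module R C M by fact
  let ?B = "full_subcategory C S" and ?F = "free_functor R C J U"
  have BO: "Obj ?B = S" and BA: "f \<in> Arr ?B \<longleftrightarrow> f \<in> Arr C \<and> Dom C f \<in> S \<and> Cod C f \<in> S"
    and BD: "Dom ?B = Dom C" "Cod ?B = Cod C" for f
    by (auto simp: full_subcategory_def)
  have F: "cat_module R C ?F" by (rule free_functor_module(1)[OF is_cring category_axioms])
  interpret F: cat_module R C ?F by (rule F)
  have UO: "i \<in> J \<Longrightarrow> U i \<in> Obj C" for i using U S by auto
  have surj: "carrier (Val M V) \<subseteq> free_eval R M x V ` carrier (Val ?F V)" if "V \<in> Obj C" for V
    by (rule free_eval_surj[OF UO x]) (use gen that in blast)+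
  note \<phi> = free_eval_nat_trans[where J = J and U = U and x = x, OF x]
  have M': "nat_trans R ?B M M (\<lambda>V x. x)"
    by (simp add: nat_trans_def mod_hom_id)
  have ex: "\<exists>\<beta>. nat_trans R C M G \<beta> \<and> (\<forall>V \<in> Obj ?B. \<forall>y \<in> carrier (Val M V). \<beta> V y = \<gamma> V y)"
    if G: "cat_module R C G" and \<gamma>: "nat_trans R ?B M G \<gamma>"
    for G :: "('o, 'm, 'k, 'c) module_functor" and \<gamma>
  proof -
    interpret G: cat_module R C G by fact
    have \<gamma>h: "\<gamma> V \<in> mod_hom R (Val M V) (Val G V)" if "V \<in> S" for V
      using \<gamma> that BO by (auto simp: nat_trans_def)
    let ?y = "\<lambda>i. \<gamma> (U i) (x i)"
    have y: "?y i \<in> carrier (Val G (U i))" if "i \<in> J" for i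
      using mod_homD(1)[OF \<gamma>h[OF U] x] that by blast
    note \<psi> = G.free_eval_nat_trans[where J = J and U = U and x = ?y, OF y]
    \<comment> \<open>Naturality of \<open>\<gamma>\<close> is available for arrows between objects of \<open>S\<close> only; it applies here because
      both \<open>U i\<close> and \<open>V\<close> lie in \<open>S\<close>.\<close>
    have tri: "free_eval R G ?y V c = \<gamma> V (free_eval R M x V c)"
      if V: "V \<in> S" and c: "c \<in> carrier (Val ?F V)" for V c
    proof -
      have VO: "V \<in> Obj C" using V S by auto
      have Val: "Val ?F V = free_module R (SIGMA i:J. Hom C (U i) V)" by (simp add: free_functor_def)
      show ?thesis
      proof (rule free_module_hom_eqI[OF G.Val_module[OF VO]
            G.free_eval_hom[where J = J and U = U and x = ?y, OF VO y, unfolded Val]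
            mod_hom_comp[OF free_eval_hom[where J = J and U = U and x = x, OF VO x] \<gamma>h[OF V], unfolded Val]])
        fix j assume "j \<in> (SIGMA i:J. Hom C (U i) V)"
        then obtain i f where j: "j = (i, f)" "i \<in> J" "f \<in> Hom C (U i) V" by auto
        have "\<gamma> V (Map M f (x i)) = Map G f (?y i)"
          using \<gamma> j U[OF j(2)] V x[OF j(2)] unfolding nat_trans_def BD by (auto simp: BA Hom_def)
        then show "free_eval R G ?y V (unit_vec R j) = \<gamma> V (free_eval R M x V (unit_vec R j))"
          using j free_eval_unit_vec[where U = U and x = x, OF x[OF j(2)] j(3)]
            G.free_eval_unit_vec[where U = U and x = ?y, OF y[OF j(2)] j(3)] by simp
      qed (use c Val in auto)
    qed
    note K = cat_submodule_preimage[OF F G \<psi> G.zero_cat_submodule]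
    have ker: "free_eval R G ?y V c = \<zero>\<^bsub>Val G V\<^esub>"
      if "V \<in> Obj C" "c \<in> carrier (Val ?F V)" "free_eval R M x V c = \<zero>\<^bsub>Val M V\<^esub>" for V c
    proof -
      have "c \<in> {c \<in> carrier (Val ?F V). free_eval R G ?y V c \<in> {\<zero>\<^bsub>Val G V\<^esub>}}"
      proof (rule rel[OF K _ that])
        fix V c assume a: "V \<in> S" "c \<in> carrier (Val ?F V)" "free_eval R M x V c = \<zero>\<^bsub>Val M V\<^esub>"
        then have "free_eval R G ?y V c = \<zero>\<^bsub>Val G V\<^esub>"
          using mod_hom_zero[OF Val_module G.Val_module \<gamma>h, of V] S by (auto simp: tri)
        with a show "c \<in> {c \<in> carrier (Val ?F V). free_eval R G ?y V c \<in> {\<zero>\<^bsub>Val G V\<^esub>}}" by simp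
      qed
      then show ?thesis by simp
    qed
    obtain \<beta> where \<beta>: "nat_trans R C M G \<beta>"
      "\<And>V c. V \<in> Obj C \<Longrightarrow> c \<in> carrier (Val ?F V) \<Longrightarrow> \<beta> V (free_eval R M x V c) = free_eval R G ?y V c"
      using nat_trans_factor[OF F M G \<phi> \<psi> surj ker] by blast
    have "\<beta> V y = \<gamma> V y" if V: "V \<in> S" and y: "y \<in> carrier (Val M V)" for V y
    proof -
      have VO: "V \<in> Obj C" using V S by auto
      then obtain c where "c \<in> carrier (Val ?F V)" "y = free_eval R M x V c" using surj y by blast
      then show ?thesis using \<beta>(2)[OF VO] tri[OF V] by simp
    qed
    with \<beta>(1) BO show ?thesis by blast
  qed
  have uniq: "\<beta> V y = \<beta>' V y"
    if G: "cat_module R C G" and \<beta>: "nat_trans R C M G \<beta>" "nat_trans R C M G \<beta>'"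
      and a: "\<forall>V \<in> Obj ?B. \<forall>y \<in> carrier (Val M V). \<beta> V y = \<gamma> V y"
        "\<forall>V \<in> Obj ?B. \<forall>y \<in> carrier (Val M V). \<beta>' V y = \<gamma> V y"
      and V: "V \<in> Obj C" "y \<in> carrier (Val M V)"
    for G :: "('o, 'm, 'k, 'c) module_functor" and \<beta> \<beta>' \<gamma> V y
  proof -
    have "carrier (Val M V) \<subseteq> {y \<in> carrier (Val M V). \<beta> V y = \<beta>' V y}"
      by (rule gen[OF equalizer_submodule[OF M G \<beta>] _ V(1)]) (use a x U BO in auto)
    then show ?thesis using V(2) by blast
  qed
  show ?thesis unfolding left_kan_extension_def
  proof (intro conjI allI impI M M' cat_module_full_subcategory[OF M S])
    fix G :: "('o, 'm, 'k, 'c) module_functor" and \<gamma>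
    assume "cat_module R C G \<and> nat_trans R ?B M G \<gamma>"
    then have G: "cat_module R C G" "nat_trans R ?B M G \<gamma>" by auto
    show "\<exists>\<beta>. nat_trans R C M G \<beta> \<and> (\<forall>V \<in> Obj ?B. \<forall>y \<in> carrier (Val M V). \<beta> V y = \<gamma> V y)"
      by (rule ex[OF G])
    show "\<forall>V \<in> Obj C. \<forall>y \<in> carrier (Val M V). \<beta> V y = \<beta>' V y"
      if "nat_trans R C M G \<beta> \<and> nat_trans R C M G \<beta>' \<and>
        (\<forall>V \<in> Obj ?B. \<forall>y \<in> carrier (Val M V). \<beta> V y = \<gamma> V y) \<and>
        (\<forall>V \<in> Obj ?B. \<forall>y \<in> carrier (Val M V). \<beta>' V y = \<gamma> V y)" for \<beta> \<beta>'
      using that by (intro ballI uniq[OF G(1), of \<beta> \<beta>' \<gamma>]) auto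
  qed
qed

section \<open>Finite presentation over locally Noetherian categories\<close>

text \<open>The generators of a submodule \<open>T\<close> are usable against submodules \<open>S\<close> of the ambient module, since \<open>S\<close>
  restricts to a submodule of \<open>T\<close>.\<close>

lemma fin_generated_subE:
  assumes M: "cat_module R C M" and T: "cat_submodule R C M T" and fg: "fin_generated R C (sub_functor M T)"
  obtains G where "finite G" "\<And>U x. (U, x) \<in> G \<Longrightarrow> U \<in> Obj C \<and> x \<in> T U"
    "\<And>S V. cat_submodule R C M S \<Longrightarrow> (\<forall>(U, x) \<in> G. x \<in> S U) \<Longrightarrow> V \<in> Obj C \<Longrightarrow> T V \<subseteq> S V"
proof -
  interpret cat_module R C M by fact
  note TM = sub_functor_module[OF T]
  have car: "carrier (Val (sub_functor M T) V) = T V" for V by (simp add: sub_functor_def)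
  obtain G where G: "finite G" "\<And>U x. (U, x) \<in> G \<Longrightarrow> U \<in> Obj C \<and> x \<in> carrier (Val (sub_functor M T) U)"
    "\<And>S V. cat_submodule R C (sub_functor M T) S \<Longrightarrow> (\<forall>(U, x) \<in> G. x \<in> S U) \<Longrightarrow> V \<in> Obj C \<Longrightarrow>
       carrier (Val (sub_functor M T) V) \<subseteq> S V"
    by (rule fin_generatedE[OF TM fg]) (rule that; iprover)
  have GT: "U \<in> Obj C \<and> x \<in> T U" if "(U, x) \<in> G" for U x
    using G(2)[OF that] unfolding car .
  have gen: "T V \<subseteq> S V" if "cat_submodule R C M S" "\<forall>(U, x) \<in> G. x \<in> S U" "V \<in> Obj C" for S V
  proof -
    have "\<forall>(U, x) \<in> G. x \<in> {x \<in> T U. x \<in> S U}" using GT that(2) by auto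
    then have "T V \<subseteq> {x \<in> T V. x \<in> S V}"
      using G(3)[OF cat_submodule_preimage[OF TM M sub_functor_incl[OF M T] that(1)] _ that(3)]
      unfolding car by simp
    then show ?thesis by blast
  qed
  show thesis by (rule that[OF G(1)]) (erule GT, rule gen)
qed

text \<open>\<open>E\<close> consists of the objects that carry the generators and the relations in a finite presentation of \<open>M\<close>.
  The elements of the free module on generators numbered by naturals have the type
  \<open>nat \<times> 'm \<Rightarrow> 'k\<close>, which is the one named in the Noetherian hypothesis.\<close>

lemma left_kan_extension_from_finite:
  fixes M :: "('o, 'm, 'k, 'b) module_functor" and C :: "('o, 'm, 'z) category_scheme"
  assumes ln: "locally_noetherian TYPE('k) TYPE(nat \<times> 'm \<Rightarrow> 'k) C" and R: "noetherian_ring R"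
    and M: "cat_module R C M" and fg: "fin_generated R C M"
  shows "\<exists>E. finite E \<and> E \<subseteq> Obj C \<and> (\<forall>S. E \<subseteq> S \<longrightarrow> S \<subseteq> Obj C \<longrightarrow>
    left_kan_extension TYPE('c) R (full_subcategory C S) C M M (\<lambda>V x. x))"
proof -
  interpret cat_module R C M by fact
  obtain G where G: "finite G" "\<And>U x. (U, x) \<in> G \<Longrightarrow> U \<in> Obj C \<and> x \<in> carrier (Val M U)"
    "\<And>S V. cat_submodule R C M S \<Longrightarrow> (\<forall>(U, x) \<in> G. x \<in> S U) \<Longrightarrow> V \<in> Obj C \<Longrightarrow>
       carrier (Val M V) \<subseteq> S V"
    by (rule fin_generatedE[OF M fg]) (rule that; iprover)
  obtain n :: nat and g where g: "G = g ` {i. i < n}"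
    using finite_imp_nat_seg_image_inj_on[OF G(1)] by auto
  define J where "J = {i. i < n}"
  define U where "U i = fst (g i)" for i
  define x where "x i = snd (g i)" for i
  have Gx: "(V, y) \<in> G \<longleftrightarrow> (\<exists>i \<in> J. V = U i \<and> y = x i)" for V y
    unfolding g J_def U_def x_def by (auto simp: image_iff prod_eq_iff)
  have U: "U i \<in> Obj C" and x: "x i \<in> carrier (Val M (U i))" if "i \<in> J" for i
    using G(2)[of "U i" "x i"] Gx that by auto
  have gen: "carrier (Val M V) \<subseteq> T V"
    if "cat_submodule R C M T" "\<And>i. i \<in> J \<Longrightarrow> x i \<in> T (U i)" "V \<in> Obj C" for T V
    by (rule G(3)[OF that(1) _ that(3)]) (use that(2) Gx in auto)
  let ?F = "free_functor R C J U"
  have F: "cat_module R C ?F" by (rule free_functor_module(1)[OF is_cring category_axioms])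
  have fgF: "fin_generated R C ?F"
    by (rule fin_generated_free_functor[OF is_cring category_axioms _ U]) (simp_all add: J_def)
  let ?K = "\<lambda>V. {c \<in> carrier (Val ?F V). free_eval R M x V c \<in> {\<zero>\<^bsub>Val M V\<^esub>}}"
  have K: "cat_submodule R C ?F ?K"
    by (rule cat_submodule_preimage[OF F M free_eval_nat_trans[OF x] zero_cat_submodule])
  have "fin_generated R C (sub_functor ?F ?K)"
    using ln R F fgF K unfolding locally_noetherian_def by blast
  then obtain H where H: "finite H" "\<And>V c. (V, c) \<in> H \<Longrightarrow> V \<in> Obj C \<and> c \<in> ?K V"
    "\<And>S V. cat_submodule R C ?F S \<Longrightarrow> (\<forall>(U, c) \<in> H. c \<in> S U) \<Longrightarrow> V \<in> Obj C \<Longrightarrow> ?K V \<subseteq> S V"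
    by (rule fin_generated_subE[OF F K]) (rule that; iprover)
  let ?E = "U ` J \<union> fst ` H"
  have "left_kan_extension TYPE('c) R (full_subcategory C S) C M M (\<lambda>V x. x)"
    if S: "?E \<subseteq> S" "S \<subseteq> Obj C" for S
  proof (rule left_kan_extension_of_presentation[OF M S(2), where J = J and U = U and x = x])
    fix T V c
    assume T: "cat_submodule R C ?F T"
      and ker: "\<And>V c. V \<in> S \<Longrightarrow> c \<in> carrier (Val ?F V) \<Longrightarrow>
        free_eval R M x V c = \<zero>\<^bsub>Val M V\<^esub> \<Longrightarrow> c \<in> T V"
      and V: "V \<in> Obj C" and c: "c \<in> carrier (Val ?F V)" "free_eval R M x V c = \<zero>\<^bsub>Val M V\<^esub>"
    have "d \<in> T W" if "(W, d) \<in> H" for W d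
      using H(2)[OF that] S(1) that by (intro ker) force+
    then have "\<forall>(W, d) \<in> H. d \<in> T W" by blast
    then have "?K V \<subseteq> T V" by (rule H(3)[OF T _ V])
    then show "c \<in> T V" using c by blast
  qed (use S x gen in auto)
  moreover have "finite ?E" "?E \<subseteq> Obj C" using H(1,2) U by (auto simp: J_def)
  ultimately show ?thesis by blast
qed

section \<open>Ranks and automorphisms in complemented categories\<close>

context category begin

lemma Hom_Obj: "f \<in> Hom C V W \<Longrightarrow> V \<in> Obj C" "f \<in> Hom C V W \<Longrightarrow> W \<in> Obj C"
  using Dom_Obj Cod_Obj by (auto simp: Hom_def)

lemma isomorphismI:
  assumes "f \<in> Hom C V W" "g \<in> Hom C W V" "g \<cdot> f = Ide C V" "f \<cdot> g = Ide C W"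
  shows "isomorphism C f"
  using assms unfolding isomorphism_def inverse_arrows_def Hom_def by (intro exI[of _ g]) auto

lemma isomorphismE:
  assumes "isomorphism C f" "f \<in> Hom C V W"
  obtains g where "g \<in> Hom C W V" "g \<cdot> f = Ide C V" "f \<cdot> g = Ide C W"
  using assms that unfolding isomorphism_def inverse_arrows_def Hom_def by blast

lemma inverse_arrow_Hom:
  assumes f: "isomorphism C f" "f \<in> Hom C V W"
  shows "inverse_arrow C f \<in> Hom C W V"
proof -
  obtain g where g: "g \<in> Hom C W V" "g \<cdot> f = Ide C V" "f \<cdot> g = Ide C W"
    by (rule isomorphismE[OF f])
  have "g' = g" if "inverse_arrows C f g'" for g'
  proof -
    have g': "g' \<in> Hom C W V" "g' \<cdot> f = Ide C V"
      using that f(2) by (auto simp: inverse_arrows_def Hom_def)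
    then show ?thesis
      using comp_assoc[OF g(1) f(2) g'(1)] g by (simp add: comp_Ide Ide_comp)
  qed
  moreover have "inverse_arrows C f g" using g f(2) by (auto simp: inverse_arrows_def Hom_def)
  ultimately have "inverse_arrow C f = g" unfolding inverse_arrow_def by (intro the_equality)
  then show ?thesis using g(1) by simp
qed

lemma isomorphism_comp:
  assumes f: "isomorphism C f" "f \<in> Hom C U V" and g: "isomorphism C g" "g \<in> Hom C V W"
  shows "isomorphism C (g \<cdot> f)"
proof -
  obtain f' where f': "f' \<in> Hom C V U" "f' \<cdot> f = Ide C U" "f \<cdot> f' = Ide C V"
    by (rule isomorphismE[OF f])
  obtain g' where g': "g' \<in> Hom C W V" "g' \<cdot> g = Ide C V" "g \<cdot> g' = Ide C W"
    by (rule isomorphismE[OF g])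
  note gf = comp_Hom[OF f(2) g(2)] and fg' = comp_Hom[OF g'(1) f'(1)]
  have "(f' \<cdot> g') \<cdot> (g \<cdot> f) = f' \<cdot> ((g' \<cdot> g) \<cdot> f)"
    using comp_assoc[OF gf g'(1) f'(1)] comp_assoc[OF f(2) g(2) g'(1)] by simp
  moreover have "(g \<cdot> f) \<cdot> (f' \<cdot> g') = g \<cdot> ((f \<cdot> f') \<cdot> g')"
    using comp_assoc[OF fg' f(2) g(2)] comp_assoc[OF g'(1) f'(1) f(2)] by simp
  ultimately show ?thesis
    using f f' g g' by (intro isomorphismI[OF gf fg']) (simp_all add: Ide_comp)
qed

lemma isomorphic_refl: "V \<in> Obj C \<Longrightarrow> isomorphic C V V"
  unfolding isomorphic_def using Ide_Hom isomorphismI Ide_comp by blast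

lemma isomorphic_sym: "isomorphic C V W \<Longrightarrow> isomorphic C W V"
  unfolding isomorphic_def by (metis isomorphismE isomorphismI)

lemma isomorphic_trans: "isomorphic C U V \<Longrightarrow> isomorphic C V W \<Longrightarrow> isomorphic C U W"
  unfolding isomorphic_def using comp_Hom isomorphism_comp by blast

end

context symmetric_monoidal_category begin

lemma isomorphism_tensor:
  assumes f: "isomorphism A f" "f \<in> Hom A V V'" and g: "isomorphism A g" "g \<in> Hom A W W'"
  shows "isomorphism A (f \<star> g)"
proof -
  obtain f' where f': "f' \<in> Hom A V' V" "f' \<cdot> f = Ide A V" "f \<cdot> f' = Ide A V'"
    by (rule isomorphismE[OF f])
  obtain g' where g': "g' \<in> Hom A W' W" "g' \<cdot> g = Ide A W" "g \<cdot> g' = Ide A W'"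
    by (rule isomorphismE[OF g])
  note O = Hom_Obj[OF f(2)] Hom_Obj[OF g(2)]
  show ?thesis
    by (rule isomorphismI[OF tensor_Hom[OF f(2) g(2)] tensor_Hom[OF f'(1) g'(1)]])
      (simp_all add: f' g' O tensor_Ide flip: tensor_comp[OF f(2) f'(1) g(2) g'(1)] tensor_comp[OF f'(1) f(2) g'(1) g(2)])
qed

lemma isomorphic_tensor:
  "isomorphic A V V' \<Longrightarrow> isomorphic A W W' \<Longrightarrow> isomorphic A (V \<diamondop> W) (V' \<diamondop> W')"
  unfolding isomorphic_def using tensor_Hom isomorphism_tensor by blast

lemma tensor_power_Obj: "X \<in> Obj A \<Longrightarrow> tensor_power A X i \<in> Obj A"
  by (induction i) (simp_all add: unit_Obj tensor_Obj)

lemma tensor_power_add: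
  assumes X: "X \<in> Obj A"
  shows "isomorphic A (tensor_power A X i \<diamondop> tensor_power A X j) (tensor_power A X (i + j))"
proof (induction j)
  case 0
  show ?case unfolding isomorphic_def
    using runit_Hom runit_iso tensor_power_Obj[OF X] by auto
next
  case (Suc j)
  note O = tensor_power_Obj[OF X]
  have "isomorphic A (tensor_power A X i \<diamondop> (tensor_power A X j \<diamondop> X))
    ((tensor_power A X i \<diamondop> tensor_power A X j) \<diamondop> X)"
    by (rule isomorphic_sym, unfold isomorphic_def)
      (use assoc_Hom[OF O O X] assoc_iso[OF O O X] in blast)
  from isomorphic_trans[OF this isomorphic_tensor[OF Suc isomorphic_refl[OF X]]]
  show ?case by simp
qed

end

context complemented_category begin

lemma isomorphic_rank: "V \<in> Obj A \<Longrightarrow> isomorphic A V (tensor_power A X (gen_rank A X V))"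
  unfolding gen_rank_def by (rule theI'[OF generator])

lemma gen_rank_eqI: "V \<in> Obj A \<Longrightarrow> isomorphic A V (tensor_power A X i) \<Longrightarrow> gen_rank A X V = i"
  using generator isomorphic_rank by blast

lemma isomorphic_iff_rank:
  assumes "V \<in> Obj A" "W \<in> Obj A"
  shows "isomorphic A V W \<longleftrightarrow> gen_rank A X V = gen_rank A X W"
  using assms isomorphic_rank gen_rank_eqI isomorphic_trans isomorphic_sym by metis

lemma gen_rank_tensor:
  assumes "V \<in> Obj A" "W \<in> Obj A"
  shows "gen_rank A X (V \<diamondop> W) = gen_rank A X V + gen_rank A X W"
  using assms
  by (intro gen_rank_eqI tensor_Obj isomorphic_trans[OF isomorphic_tensor[OF isomorphic_rank isomorphic_rank]
        tensor_power_add[OF generator_Obj]])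

lemma initial_arrow_Hom: "V \<in> Obj A \<Longrightarrow> initial_arrow A V \<in> Hom A (unit_obj A) V"
  unfolding initial_arrow_def by (rule theI'[OF unit_initial])

lemma can_left_Hom:
  assumes "V \<in> Obj A" "W \<in> Obj A"
  shows "can_left A V W \<in> Hom A V (V \<diamondop> W)"
  unfolding can_left_def using assms
  by (intro comp_Hom[OF inverse_arrow_Hom[OF runit_iso runit_Hom] tensor_Hom[OF Ide_Hom initial_arrow_Hom]])

text \<open>Both sides are built from the arrow out of the initial object, which absorbs \<open>u\<close>.\<close>

lemma can_left_natural:
  assumes V: "V \<in> Obj A" and u: "u \<in> Hom A W W'"
  shows "(Ide A V \<star> u) \<cdot> can_left A V W = can_left A V W'"
proof -
  note O = Hom_Obj[OF u]
  note i = initial_arrow_Hom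
  have "u \<cdot> initial_arrow A W = initial_arrow A W'"
    using unit_initial[OF O(2)] comp_Hom[OF i[OF O(1)] u] i[OF O(2)] by blast
  then have "(Ide A V \<star> u) \<cdot> (Ide A V \<star> initial_arrow A W) = Ide A V \<star> initial_arrow A W'"
    using tensor_comp[OF Ide_Hom Ide_Hom i[OF O(1)] u, OF V V] V by (simp add: Ide_comp[OF Ide_Hom])
  then show ?thesis
    unfolding can_left_def
    using comp_assoc[OF inverse_arrow_Hom[OF runit_iso runit_Hom] tensor_Hom[OF Ide_Hom i] tensor_Hom[OF Ide_Hom u],
        OF V V V O(1) V] by simp
qed

text \<open>Existence of complements, with the rank of the complement read off from additivity of ranks.\<close>

lemma arrow_splits:
  assumes f: "f \<in> Hom A V W"
  obtains D \<phi> where "D \<in> Obj A" "\<phi> \<in> Hom A (V \<diamondop> D) W" "isomorphism A \<phi>"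
    "\<phi> \<cdot> can_left A V D = f" "gen_rank A X W = gen_rank A X V + gen_rank A X D"
proof -
  have fA: "f \<in> Arr A" and DC: "Dom A f = V" "Cod A f = W" using f by (auto simp: Hom_def)
  obtain d where d: "d \<in> Arr A" "is_complement A W f d" using complement_exists[OF fA] DC by auto
  let ?D = "Dom A d"
  have D: "?D \<in> Obj A" using Dom_Obj[OF d(1)] .
  note O = Hom_Obj[OF f]
  obtain \<phi> where \<phi>: "\<phi> \<in> Hom A (V \<diamondop> ?D) W" "isomorphism A \<phi>" "\<phi> \<cdot> can_left A V ?D = f"
    using d(2) DC unfolding is_complement_def by auto
  then have "isomorphic A (V \<diamondop> ?D) W" unfolding isomorphic_def by blast
  then have "gen_rank A X W = gen_rank A X V + gen_rank A X ?D"
    using isomorphic_iff_rank gen_rank_tensor tensor_Obj O D by metis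
  then show ?thesis using that D \<phi> by blast
qed

lemma Hom_nonempty_iff_rank_le:
  assumes "V \<in> Obj A" "W \<in> Obj A"
  shows "Hom A V W \<noteq> {} \<longleftrightarrow> gen_rank A X V \<le> gen_rank A X W"
proof
  assume "Hom A V W \<noteq> {}"
  then obtain f where "f \<in> Hom A V W" by blast
  then show "gen_rank A X V \<le> gen_rank A X W" by (rule arrow_splits) simp
next
  assume le: "gen_rank A X V \<le> gen_rank A X W"
  let ?D = "tensor_power A X (gen_rank A X W - gen_rank A X V)"
  have D: "?D \<in> Obj A" by (rule tensor_power_Obj[OF generator_Obj])
  have "gen_rank A X ?D = gen_rank A X W - gen_rank A X V"
    by (rule gen_rank_eqI[OF D isomorphic_refl[OF D]])
  then have "isomorphic A (V \<diamondop> ?D) W"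
    using assms D le by (simp add: isomorphic_iff_rank tensor_Obj gen_rank_tensor)
  then obtain \<phi> where "\<phi> \<in> Hom A (V \<diamondop> ?D) W" unfolding isomorphic_def by blast
  from comp_Hom[OF can_left_Hom[OF assms(1) D] this] show "Hom A V W \<noteq> {}" by blast
qed

text \<open>Split \<open>W\<close> along both arrows.  The complements \<open>D\<close> and \<open>E\<close> have the same rank, so there is an isomorphism
  \<open>u\<close> between them, and the automorphism is \<open>Ide A V \<star> u\<close> transported along the two splittings.\<close>

lemma Aut_transitive:
  assumes f: "f \<in> Hom A V W" and g: "g \<in> Hom A V W"
  shows "\<exists>\<sigma> \<in> Aut A W. \<sigma> \<cdot> f = g"
proof -
  obtain D \<phi> where D: "D \<in> Obj A" "\<phi> \<in> Hom A (V \<diamondop> D) W" "isomorphism A \<phi>"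
    "\<phi> \<cdot> can_left A V D = f" "gen_rank A X W = gen_rank A X V + gen_rank A X D"
    by (rule arrow_splits[OF f])
  obtain E \<psi> where E: "E \<in> Obj A" "\<psi> \<in> Hom A (V \<diamondop> E) W" "isomorphism A \<psi>"
    "\<psi> \<cdot> can_left A V E = g" "gen_rank A X W = gen_rank A X V + gen_rank A X E"
    by (rule arrow_splits[OF g])
  have "isomorphic A D E" using D E by (simp add: isomorphic_iff_rank)
  then obtain u where u: "u \<in> Hom A D E" "isomorphism A u" unfolding isomorphic_def by blast
  obtain \<phi>' where \<phi>': "\<phi>' \<in> Hom A W (V \<diamondop> D)" "\<phi>' \<cdot> \<phi> = Ide A (V \<diamondop> D)" "\<phi> \<cdot> \<phi>' = Ide A W"
    by (rule isomorphismE[OF D(3,2)])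
  have V: "V \<in> Obj A" by (rule Hom_Obj[OF f])
  note cl = can_left_Hom[OF V D(1)]
  note i = Ide_Hom[OF V]
  let ?u = "Ide A V \<star> u"
  have uH: "?u \<in> Hom A (V \<diamondop> D) (V \<diamondop> E)" by (rule tensor_Hom[OF i u(1)])
  have ui: "isomorphism A ?u"
    by (rule isomorphism_tensor[OF isomorphismI[OF i i] i u(2,1)]) (simp_all add: Ide_comp[OF i])
  note \<psi>u = comp_Hom[OF uH E(2)] isomorphism_comp[OF ui uH E(3,2)]
  have "isomorphism A \<phi>'" using isomorphismI[OF \<phi>'(1) D(2) \<phi>'(3,2)] .
  from isomorphism_comp[OF this \<phi>'(1) \<psi>u(2,1)] comp_Hom[OF \<phi>'(1) \<psi>u(1)]
  have "(\<psi> \<cdot> ?u) \<cdot> \<phi>' \<in> Aut A W" by (simp add: Aut_def)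
  moreover have "((\<psi> \<cdot> ?u) \<cdot> \<phi>') \<cdot> f = g"
  proof -
    have "\<phi>' \<cdot> f = can_left A V D"
      using comp_assoc[OF cl D(2) \<phi>'(1)] \<phi>'(2) D(4) Ide_comp[OF cl] by simp
    then have "((\<psi> \<cdot> ?u) \<cdot> \<phi>') \<cdot> f = (\<psi> \<cdot> ?u) \<cdot> can_left A V D"
      using comp_assoc[OF f \<phi>'(1) \<psi>u(1)] by simp
    also have "\<dots> = g"
      using comp_assoc[OF cl uH E(2)] can_left_natural[OF V u(1)] E(4) by simp
    finally show ?thesis .
  qed
  ultimately show ?thesis by blast
qed

text \<open>Any arrow from \<open>U\<close> to \<open>W\<close> works after correction by an automorphism of \<open>W\<close>.\<close>

lemma factor_through:
  assumes f: "f \<in> Hom A V W" and g: "g \<in> Hom A V U" and le: "gen_rank A X U \<le> gen_rank A X W"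
  shows "\<exists>k \<in> Hom A U W. k \<cdot> g = f"
proof -
  obtain k where k: "k \<in> Hom A U W"
    using Hom_nonempty_iff_rank_le[of U W] le Hom_Obj[OF f] Hom_Obj[OF g] by auto
  obtain \<sigma> where \<sigma>: "\<sigma> \<in> Hom A W W" "\<sigma> \<cdot> (k \<cdot> g) = f"
    using Aut_transitive[OF comp_Hom[OF g k] f] by (auto simp: Aut_def)
  then show ?thesis using comp_assoc[OF g k \<sigma>(1)] comp_Hom[OF k \<sigma>(1)] by auto
qed

end

section \<open>Representation stability\<close>

text \<open>In a complemented category with \<open>r\<close> the rank, the union of these sets over \<open>n\<close> is the torsion of \<open>M\<close>,
  the set of elements that some arrow kills.  Imposing vanishing on all arrows to objects of
  large rank, instead of on a single arrow, makes each stage a submodule for an arbitrary rank function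
  \<open>r\<close>; that a single arrow suffices is \<open>vanishing_fromI\<close> below.\<close>

definition vanishing_from ::
  "('o, 'm, 'z) category_scheme \<Rightarrow> ('o \<Rightarrow> nat) \<Rightarrow> ('o, 'm, 'k, 'b) module_functor \<Rightarrow> nat \<Rightarrow> 'o \<Rightarrow> 'b set" where
  "vanishing_from C r M n V =
     {x \<in> carrier (Val M V). \<forall>W. \<forall>f \<in> Hom C V W. n \<le> r W \<longrightarrow> Map M f x = \<zero>\<^bsub>Val M W\<^esub>}"

lemma vanishing_from_mono: "m \<le> n \<Longrightarrow> vanishing_from C r M m V \<subseteq> vanishing_from C r M n V"
  by (auto simp: vanishing_from_def)

lemma (in cat_module) vanishing_from_submodule: "cat_submodule R C M (vanishing_from C r M n)"
  unfolding cat_submodule_def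
proof (intro conjI ballI)
  show "submodule (vanishing_from C r M n V) R (Val M V)" if V: "V \<in> Obj C" for V
  proof -
    interpret V: module R "Val M V" by (rule Val_module[OF V])
    have W: "module R (Val M W)" if "f \<in> Hom C V W" for f W using Hom_Obj[OF that] Val_module by blast
    have z: "\<zero>\<^bsub>Val M W\<^esub> \<oplus>\<^bsub>Val M W\<^esub> \<zero>\<^bsub>Val M W\<^esub> = \<zero>\<^bsub>Val M W\<^esub>"
      "a \<in> carrier R \<Longrightarrow> a \<odot>\<^bsub>Val M W\<^esub> \<zero>\<^bsub>Val M W\<^esub> = \<zero>\<^bsub>Val M W\<^esub>" if f: "f \<in> Hom C V W" for f W a
    proof -
      interpret W: module R "Val M W" by (rule W[OF f])
      show "\<zero>\<^bsub>Val M W\<^esub> \<oplus>\<^bsub>Val M W\<^esub> \<zero>\<^bsub>Val M W\<^esub> = \<zero>\<^bsub>Val M W\<^esub>"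
        "a \<in> carrier R \<Longrightarrow> a \<odot>\<^bsub>Val M W\<^esub> \<zero>\<^bsub>Val M W\<^esub> = \<zero>\<^bsub>Val M W\<^esub>" by simp_all
    qed
    show ?thesis
      by (rule V.submoduleI')
        (auto simp: vanishing_from_def mod_homD[OF Map_hom] z mod_hom_zero[OF V.module_axioms W Map_hom])
  qed
  fix f assume f: "f \<in> Arr C"
  then have fH: "f \<in> Hom C (Dom C f) (Cod C f)" by (simp add: Hom_def)
  show "Map M f ` vanishing_from C r M n (Dom C f) \<subseteq> vanishing_from C r M n (Cod C f)"
  proof (rule image_subsetI)
    fix x assume x: "x \<in> vanishing_from C r M n (Dom C f)"
    then have xc: "x \<in> carrier (Val M (Dom C f))" by (simp add: vanishing_from_def)
    have "Map M g (Map M f x) = \<zero>\<^bsub>Val M W\<^esub>" if g: "g \<in> Hom C (Cod C f) W" "n \<le> r W" for g W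
      using x g(2) comp_Hom[OF fH g(1)] Map_comp[OF fH g(1) xc] by (simp add: vanishing_from_def)
    then show "Map M f x \<in> vanishing_from C r M n (Cod C f)"
      using mod_homD(1)[OF Map_hom[OF fH] xc] by (simp add: vanishing_from_def)
  qed
qed

lemma (in cat_module) incseq_Union_submodule:
  fixes S :: "nat \<Rightarrow> 'o \<Rightarrow> 'b set"
  assumes S: "\<And>n. cat_submodule R C M (S n)" and mono: "\<And>m n V. m \<le> n \<Longrightarrow> S m V \<subseteq> S n V"
  shows "cat_submodule R C M (\<lambda>V. \<Union>n. S n V)"
  unfolding cat_submodule_def
proof (intro conjI ballI)
  show "submodule (\<Union>n. S n V) R (Val M V)" if V: "V \<in> Obj C" for V
  proof -
    interpret V: module R "Val M V" by (rule Val_module[OF V])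
    note sub = cat_submoduleD(1)[OF S V]
    note cl = submodule_closed[OF V.module_axioms sub]
    show ?thesis
    proof (rule V.submoduleI')
      fix a b assume "a \<in> (\<Union>n. S n V)" "b \<in> (\<Union>n. S n V)"
      then obtain m n where "a \<in> S m V" "b \<in> S n V" by blast
      then have "a \<in> S (max m n) V" "b \<in> S (max m n) V"
        using mono[of m "max m n" V] mono[of n "max m n" V] by auto
      then show "a \<oplus>\<^bsub>Val M V\<^esub> b \<in> (\<Union>n. S n V)" using cl(2) by blast
    next
      show "(\<Union>n. S n V) \<subseteq> carrier (Val M V)" using cl(1) by (rule UN_least)
      show "\<zero>\<^bsub>Val M V\<^esub> \<in> (\<Union>n. S n V)" using submodule_zero[OF sub[of 0]] by auto
      fix a x assume "a \<in> carrier R" "x \<in> (\<Union>n. S n V)"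
      then show "a \<odot>\<^bsub>Val M V\<^esub> x \<in> (\<Union>n. S n V)" using cl(3) by auto
    qed
  qed
  show "Map M f ` (\<Union>n. S n (Dom C f)) \<subseteq> (\<Union>n. S n (Cod C f))" if "f \<in> Arr C" for f
    using cat_submoduleD(2)[OF S that] by auto
qed

text \<open>An arrow to an object of rank at least that of \<open>W\<close> factors through \<open>f\<close>.\<close>

lemma (in complemented_category) vanishing_fromI:
  assumes M: "cat_module R A M" and f: "f \<in> Hom A V W" and x: "x \<in> carrier (Val M V)"
    and z: "Map M f x = \<zero>\<^bsub>Val M W\<^esub>"
  shows "x \<in> vanishing_from A (gen_rank A X) M (gen_rank A X W) V"
proof -
  interpret M: cat_module R A M by fact
  have "Map M g x = \<zero>\<^bsub>Val M U\<^esub>" if g: "g \<in> Hom A V U" "gen_rank A X W \<le> gen_rank A X U" for g U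
  proof -
    obtain k where k: "k \<in> Hom A W U" "k \<cdot> f = g" using factor_through[OF g(1) f g(2)] by blast
    have "Map M g x = Map M k (Map M f x)" using M.Map_comp[OF f k(1) x] k(2) by simp
    then show ?thesis
      using z mod_hom_zero[OF M.Val_module M.Val_module M.Map_hom[OF k(1)]] Hom_Obj[OF k(1)] by simp
  qed
  then show ?thesis using x by (simp add: vanishing_from_def)
qed

text \<open>Finite generation makes the increasing union \<open>?T\<close> of the submodules \<open>?K n\<close> equal to one stage
  \<open>?K N\<close>.\<close>

theorem (in complemented_category) injective_stability:
  fixes R :: "'k ring" and M :: "('o, 'm, 'k, 'b) module_functor"
  assumes ln: "locally_noetherian TYPE('k) TYPE('b) A" and R: "noetherian_ring R"
    and M: "cat_module R A M" and fg: "fin_generated R A M"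
  shows "\<exists>N. \<forall>V W. \<forall>f \<in> Hom A V W. N \<le> gen_rank A X V \<longrightarrow> inj_on (Map M f) (carrier (Val M V))"
proof -
  interpret M: cat_module R A M by fact
  let ?K = "vanishing_from A (gen_rank A X) M"
  let ?T = "\<lambda>V. \<Union>n. ?K n V"
  have T: "cat_submodule R A M ?T"
    by (rule M.incseq_Union_submodule[OF M.vanishing_from_submodule vanishing_from_mono])
  have "fin_generated R A (sub_functor M ?T)"
    using ln R M fg T unfolding locally_noetherian_def by blast
  then obtain G where G: "finite G" "\<And>U x. (U, x) \<in> G \<Longrightarrow> U \<in> Obj A \<and> x \<in> ?T U"
    "\<And>S V. cat_submodule R A M S \<Longrightarrow> (\<forall>(U, x) \<in> G. x \<in> S U) \<Longrightarrow> V \<in> Obj A \<Longrightarrow> ?T V \<subseteq> S V"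
    by (rule fin_generated_subE[OF M T]) (rule that; iprover)
  have "\<forall>p \<in> G. \<exists>n. snd p \<in> ?K n (fst p)" using G(2) by fastforce
  then obtain \<nu> where \<nu>: "\<And>p. p \<in> G \<Longrightarrow> snd p \<in> ?K (\<nu> p) (fst p)" by metis
  define N where "N = Max (insert 0 (\<nu> ` G))"
  have "x \<in> ?K N U" if "(U, x) \<in> G" for U x
  proof -
    have "\<nu> (U, x) \<le> N" using G(1) that by (simp add: N_def)
    then show ?thesis using \<nu>[OF that] vanishing_from_mono[of "\<nu> (U, x)" N A "gen_rank A X" M U] by auto
  qed
  then have "\<forall>(U, x) \<in> G. x \<in> ?K N U" by blast
  note TK = G(3)[OF M.vanishing_from_submodule this]
  have "inj_on (Map M f) (carrier (Val M V))"
    if f: "f \<in> Hom A V W" and N: "N \<le> gen_rank A X V" for f V W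
  proof (rule inj_onI)
    fix x y assume x: "x \<in> carrier (Val M V)" and y: "y \<in> carrier (Val M V)" and eq: "Map M f x = Map M f y"
    note O = Hom_Obj[OF f]
    interpret V: module R "Val M V" by (rule M.Val_module[OF O(1)])
    let ?d = "x \<ominus>\<^bsub>Val M V\<^esub> y"
    have d: "?d \<in> carrier (Val M V)" using x y by simp
    have "Map M f ?d = \<zero>\<^bsub>Val M W\<^esub>"
      using mod_hom_eq_iff[OF M.Val_module[OF O(1)] M.Val_module[OF O(2)] M.Map_hom[OF f] x y] eq by simp
    then have "?d \<in> ?K N V" using vanishing_fromI[OF M f d] TK[OF O(1)] by blast
    \<comment> \<open>The rank of \<open>V\<close> itself is at least \<open>N\<close>, so the identity of \<open>V\<close> kills the difference.\<close>
    then have "Map M (Ide A V) ?d = \<zero>\<^bsub>Val M V\<^esub>"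
      using Ide_Hom[OF O(1)] N by (auto simp: vanishing_from_def)
    then have "Map M (Ide A V) x = Map M (Ide A V) y"
      using mod_hom_eq_iff[OF M.Val_module M.Val_module M.Map_hom[OF Ide_Hom], OF O(1) O(1) O(1) x y] by simp
    then show "x = y" using M.Map_Ide[OF O(1)] x y by simp
  qed
  then show ?thesis by blast
qed

text \<open>The span of the images \<open>?Z\<close> of the generators is a submodule containing them, hence everything.  By
  transitivity an arrow \<open>g\<close> from the object of a generator to \<open>W\<close> has the form \<open>\<sigma> \<cdot> (f \<cdot> h)\<close>, which
  puts \<open>?Z\<close> inside the orbit of the image of \<open>f\<close>.\<close>

theorem (in complemented_category) surjective_stability:
  fixes R :: "'k ring" and M :: "('o, 'm, 'k, 'b) module_functor"
  assumes M: "cat_module R A M" and fg: "fin_generated R A M"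
  shows "\<exists>N. \<forall>V W. \<forall>f \<in> Hom A V W. N \<le> gen_rank A X V \<longrightarrow>
    mod_span R (Val M W) (\<Union>g \<in> Aut A W. Map M g ` Map M f ` carrier (Val M V)) = carrier (Val M W)"
proof -
  interpret M: cat_module R A M by fact
  obtain G where G: "finite G" "\<And>U x. (U, x) \<in> G \<Longrightarrow> U \<in> Obj A \<and> x \<in> carrier (Val M U)"
    "\<And>S V. cat_submodule R A M S \<Longrightarrow> (\<forall>(U, x) \<in> G. x \<in> S U) \<Longrightarrow> V \<in> Obj A \<Longrightarrow>
       carrier (Val M V) \<subseteq> S V"
    by (rule fin_generatedE[OF M fg]) (rule that; iprover)
  define N where "N = Max (insert 0 ((\<lambda>p. gen_rank A X (fst p)) ` G))"
  let ?Z = "\<lambda>V. {Map M g x | U x g. (U, x) \<in> G \<and> g \<in> Hom A U V}"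
  have Zc: "?Z V \<subseteq> carrier (Val M V)" for V
    using G(2) mod_homD(1)[OF M.Map_hom] by blast
  have Zspan: "cat_submodule R A M (\<lambda>V. mod_span R (Val M V) (?Z V))"
  proof (rule M.span_cat_submodule[OF Zc])
    fix f assume "f \<in> Arr A"
    then have f: "f \<in> Hom A (Dom A f) (Cod A f)" by (simp add: Hom_def)
    show "Map M f ` ?Z (Dom A f) \<subseteq> ?Z (Cod A f)"
    proof (rule image_subsetI)
      fix y assume "y \<in> ?Z (Dom A f)"
      then obtain U x g where p: "(U, x) \<in> G" "g \<in> Hom A U (Dom A f)" "y = Map M g x" by blast
      then have "Map M f y = Map M (f \<cdot> g) x" using M.Map_comp[OF p(2) f] G(2) by simp
      then show "Map M f y \<in> ?Z (Cod A f)" using p(1) comp_Hom[OF p(2) f] by blast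
    qed
  qed
  have "x \<in> mod_span R (Val M U) (?Z U)" if p: "(U, x) \<in> G" for U x
  proof -
    have U: "U \<in> Obj A" "x \<in> carrier (Val M U)" using G(2)[OF p] by auto
    then have "x \<in> ?Z U" using M.Map_Ide[OF U] Ide_Hom[OF U(1)] p by force
    then show ?thesis using mod_span_module(2)[OF M.Val_module[OF U(1)] Zc] by blast
  qed
  then have all: "carrier (Val M V) \<subseteq> mod_span R (Val M V) (?Z V)" if "V \<in> Obj A" for V
    using G(3)[OF Zspan _ that] by blast
  have "mod_span R (Val M W) (\<Union>g \<in> Aut A W. Map M g ` Map M f ` carrier (Val M V)) = carrier (Val M W)"
    if f: "f \<in> Hom A V W" and N: "N \<le> gen_rank A X V" for f V W
  proof -
    note O = Hom_Obj[OF f]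
    let ?Y = "\<Union>g \<in> Aut A W. Map M g ` Map M f ` carrier (Val M V)"
    have Yc: "?Y \<subseteq> carrier (Val M W)"
      using mod_homD(1)[OF M.Map_hom] f by (fastforce simp: Aut_def)
    note Y = mod_span_module[OF M.Val_module[OF O(2)] Yc]
    have "?Z W \<subseteq> ?Y"
    proof
      fix y assume "y \<in> ?Z W"
      then obtain U x g where p: "(U, x) \<in> G" "g \<in> Hom A U W" "y = Map M g x" by blast
      have U: "U \<in> Obj A" "x \<in> carrier (Val M U)" using G(2)[OF p(1)] by auto
      have "gen_rank A X U \<le> N" unfolding N_def using G(1) p(1) by (intro Max_ge) force+
      then obtain h where h: "h \<in> Hom A U V" using Hom_nonempty_iff_rank_le[OF U(1) O(1)] N by auto
      note fh = comp_Hom[OF h f]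
      obtain \<sigma> where \<sigma>: "\<sigma> \<in> Aut A W" "\<sigma> \<cdot> (f \<cdot> h) = g" using Aut_transitive[OF fh p(2)] by blast
      then have "y = Map M \<sigma> (Map M f (Map M h x))"
        using M.Map_comp[OF fh _ U(2), of \<sigma> W] M.Map_comp[OF h f U(2)] p(3) by (simp add: Aut_def)
      then show "y \<in> ?Y" using \<sigma>(1) mod_homD(1)[OF M.Map_hom[OF h] U(2)] by blast
    qed
    then have "carrier (Val M W) \<subseteq> mod_span R (Val M W) ?Y"
      using all[OF O(2)] mod_span_module(3)[OF M.Val_module[OF O(2)] Zc Y(1)] Y(2) by blast
    moreover have "mod_span R (Val M W) ?Y \<subseteq> carrier (Val M W)"
      by (rule submodule_closed(1)[OF M.Val_module[OF O(2)] Y(1)])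
    ultimately show ?thesis by blast
  qed
  then show ?thesis by blast
qed

text \<open>The objects of rank at most \<open>N\<close> contain a given finite set of objects as soon as \<open>N\<close> is large.\<close>

theorem (in complemented_category) central_stability:
  fixes R :: "'k ring" and M :: "('o, 'm, 'k, 'b) module_functor"
  assumes "locally_noetherian TYPE('k) TYPE(nat \<times> 'm \<Rightarrow> 'k) A" "noetherian_ring R"
    "cat_module R A M" "fin_generated R A M"
  shows "\<exists>N0. \<forall>N \<ge> N0. left_kan_extension TYPE('c) R (rank_subcategory A X N) A M M (\<lambda>V x. x)"
proof -
  obtain E where E: "finite E" "E \<subseteq> Obj A" "\<And>S. E \<subseteq> S \<Longrightarrow> S \<subseteq> Obj A \<Longrightarrow>
      left_kan_extension TYPE('c) R (full_subcategory A S) A M M (\<lambda>V x. x)"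
    using left_kan_extension_from_finite[OF assms, where ?'c = 'c] by blast
  have "left_kan_extension TYPE('c) R (rank_subcategory A X N) A M M (\<lambda>V x. x)"
    if N: "Max (insert 0 (gen_rank A X ` E)) \<le> N" for N
    unfolding rank_subcategory_def using E(1,2) N by (intro E(3)) auto
  then show ?thesis by blast
qed

theorem theorem6:
  fixes A :: "('o, 'm) monoidal_category"
    and X :: 'o
    and R :: "'k ring"
    and M :: "('o, 'm, 'k, 'b) module_functor"
  assumes "complemented_category A X"
    and "locally_noetherian TYPE('k) TYPE(nat \<times> 'm \<Rightarrow> 'k) A"
    and "noetherian_ring R"
    and "cat_module R A M"
    and "fin_generated R A M"
  shows "(\<exists>N1. \<forall>V \<in> Obj A. \<forall>W \<in> Obj A. \<forall>f \<in> Hom A V W. N1 \<le> gen_rank A X V \<longrightarrow>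
            inj_on (Map M f) (carrier (Val M V))) \<and>
         (\<exists>N2. \<forall>V \<in> Obj A. \<forall>W \<in> Obj A. \<forall>f \<in> Hom A V W. N2 \<le> gen_rank A X V \<longrightarrow>
            mod_span R (Val M W) (\<Union>g \<in> Aut A W. Map M g ` Map M f ` carrier (Val M V)) =
              carrier (Val M W)) \<and>
         (\<exists>N3. \<forall>N \<ge> N3. left_kan_extension TYPE('m \<Rightarrow> 'b) R (rank_subcategory A X N) A
            M M (\<lambda>V x. x))"
proof -
  interpret complemented_category A X by (rule assms(1))
  note inj = injective_stability[OF locally_noetherian_any_type[OF assms(2)] assms(3-5)]
  note surj = surjective_stability[OF assms(4,5)]
  note kan = central_stability[OF assms(2-5), where ?'c = "'m \<Rightarrow> 'b"]
  show ?thesis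
    by (intro conjI ex_forward[OF inj] ex_forward[OF surj] kan) simp_all
qed

end
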